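(* Let $\mathbb{F}$ be a local field of characteristic distinct from $2$. Then $\mathrm{SL}(n,\mathbb{F})$ and the projective special linear group $\mathrm{PSL}(n,\mathbb{F})=\mathrm{SL}(n,\mathbb{F})/Z(\mathrm{SL}(n,\mathbb{F}))$ are totally minimal for every positive integer $n$.
   Context: A local field is a non-discrete locally compact (Hausdorff) topological field. $\mathrm{SL}(n,\mathbb{F})$ is the group of $n\times n$ matrices over $\mathbb{F}$ of determinant $1$, with the pointwise topology inherited from $\mathbb{F}^{n^2}$; $Z(G)$ denotes the center of $G$, and $\mathrm{PSL}(n,\mathbb{F})$ carries the quotient topology. All topological groups are Hausdorff. A topological group is minimal if it admits no strictly coarser Hausdorff group topology; $G$ is totally minimal if every Hausdorff quotient group $G/N$ ($N$ a closed normal subgroup) is minimal. *)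

theory Defs
  imports "HOL-Analysis.Analysis" "HOL-Algebra.Coset"
begin

class topological_field =
  topological_ab_group_add + topological_comm_monoid_mult + t2_space + field +
  assumes tendsto_inverse_nhds: "a \<noteq> 0 \<Longrightarrow> (inverse \<longlongrightarrow> inverse a) (nhds a)"

class local_field = topological_field +
  assumes nondiscrete: "\<not> (\<forall>S. open S)"
    and locally_compact: "\<exists>U K. open U \<and> compact K \<and> x \<in> U \<and> U \<subseteq> K"

lemma locally_compact_space_local_field:
  "locally_compact_space (euclidean :: 'a::local_field topology)"
  unfolding locally_compact_space_def
  by (simp only: open_openin[symmetric] compactin_euclidean_iff locally_compact simp_thms ball_triv)

definition hausdorff_topological_group :: "('a, 'b) monoid_scheme \<Rightarrow> 'a topology \<Rightarrow> bool" where
  "hausdorff_topological_group G T \<longleftrightarrow>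
     group G \<and> topspace T = carrier G \<and> Hausdorff_space T \<and>
     continuous_map (prod_topology T T) T (\<lambda>(x, y). x \<otimes>\<^bsub>G\<^esub> y) \<and>
     continuous_map T T (\<lambda>x. inv\<^bsub>G\<^esub> x)"

definition minimal_topological_group :: "('a, 'b) monoid_scheme \<Rightarrow> 'a topology \<Rightarrow> bool" where
  "minimal_topological_group G T \<longleftrightarrow>
     hausdorff_topological_group G T \<and>
     (\<forall>T'. hausdorff_topological_group G T' \<and> (\<forall>U. openin T' U \<longrightarrow> openin T U) \<longrightarrow> T' = T)"

definition quotient_topology :: "'a topology \<Rightarrow> ('a \<Rightarrow> 'b) \<Rightarrow> 'b topology" where
  "quotient_topology X f =
     topology (\<lambda>U. U \<subseteq> f ` topspace X \<and> openin X {x \<in> topspace X. f x \<in> U})"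

lemma openin_quotient_topology:
  "openin (quotient_topology X f) U \<longleftrightarrow>
     U \<subseteq> f ` topspace X \<and> openin X {x \<in> topspace X. f x \<in> U}"
proof -
  let ?P = "\<lambda>U. U \<subseteq> f ` topspace X \<and> openin X {x \<in> topspace X. f x \<in> U}"
  have "?P (S \<inter> T)" if "?P S" "?P T" for S T
  proof -
    have "{x \<in> topspace X. f x \<in> S \<inter> T} =
        {x \<in> topspace X. f x \<in> S} \<inter> {x \<in> topspace X. f x \<in> T}" by blast
    moreover have "openin X ({x \<in> topspace X. f x \<in> S} \<inter> {x \<in> topspace X. f x \<in> T})"
      by (rule openin_Int) (use that in blast)+
    moreover have "S \<inter> T \<subseteq> f ` topspace X" using that by blast
    ultimately show ?thesis by (simp only: simp_thms)
  qed
  moreover have "?P (\<Union>K)" if K: "\<forall>S\<in>K. ?P S" for K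
  proof -
    have "{x \<in> topspace X. f x \<in> \<Union>K} = \<Union> ((\<lambda>S. {x \<in> topspace X. f x \<in> S}) ` K)" by blast
    moreover have "openin X (\<Union> ((\<lambda>S. {x \<in> topspace X. f x \<in> S}) ` K))"
      by (rule openin_Union) (use K in blast)
    moreover have "\<Union>K \<subseteq> f ` topspace X" using K by blast
    ultimately show ?thesis by (simp only: simp_thms)
  qed
  ultimately have "istopology ?P"
    unfolding istopology_def by blast
  then show ?thesis
    unfolding quotient_topology_def by (simp only: topology_inverse')
qed

lemma topspace_quotient_topology: "topspace (quotient_topology X f) = f ` topspace X"
proof (rule antisym)
  show "topspace (quotient_topology X f) \<subseteq> f ` topspace X"
    using openin_topspace[of "quotient_topology X f"] by (simp only: openin_quotient_topology)
  have "{x \<in> topspace X. f x \<in> f ` topspace X} = topspace X" by auto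
  then show "f ` topspace X \<subseteq> topspace (quotient_topology X f)"
    by (intro openin_subset) (simp add: openin_quotient_topology)
qed

lemma quotient_map_quotient_topology: "quotient_map X (quotient_topology X f) f"
  unfolding quotient_map_def topspace_quotient_topology openin_quotient_topology by simp

definition quotient_group_topology ::
    "('a, 'b) monoid_scheme \<Rightarrow> 'a topology \<Rightarrow> 'a set \<Rightarrow> 'a set topology" where
  "quotient_group_topology G T N = quotient_topology T (\<lambda>x. N #>\<^bsub>G\<^esub> x)"

definition totally_minimal_topological_group ::
    "('a, 'b) monoid_scheme \<Rightarrow> 'a topology \<Rightarrow> bool" where
  "totally_minimal_topological_group G T \<longleftrightarrow>
     hausdorff_topological_group G T \<and>
     (\<forall>N. N \<lhd> G \<and> closedin T N \<longrightarrow>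
        minimal_topological_group (G Mod N) (quotient_group_topology G T N))"

definition group_center :: "('a, 'b) monoid_scheme \<Rightarrow> 'a set" where
  "group_center G = {z \<in> carrier G. \<forall>g \<in> carrier G. z \<otimes>\<^bsub>G\<^esub> g = g \<otimes>\<^bsub>G\<^esub> z}"

definition SL :: "('a::comm_ring_1 ^ 'n::finite ^ 'n) monoid" where
  "SL = \<lparr>carrier = {A. det A = 1}, mult = (**), one = mat 1\<rparr>"

text \<open>The library topology on \<^typ>\<open>'a ^ 'n ^ 'n\<close> is the product topology, i.e. that of entrywise
  (pointwise) convergence.\<close>

definition SL_topology :: "('a::{comm_ring_1, topological_space} ^ 'n::finite ^ 'n) topology" where
  "SL_topology = top_of_set (carrier SL)"

definition PSL :: "('a::comm_ring_1 ^ 'n::finite ^ 'n) set monoid" where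
  "PSL = SL Mod (group_center SL)"

definition PSL_topology ::
    "('a::{comm_ring_1, topological_space} ^ 'n::finite ^ 'n) set topology" where
  "PSL_topology = quotient_group_topology SL SL_topology (group_center SL)"

end

(*
Let phi be a continuous surjective homomorphism from SL(n,F) onto a Hausdorff group H. Total
minimality, of SL and of its quotients, amounts to phi being a quotient map. If some neighbourhood
of 1 has a relatively compact preimage, this is a compactness argument. Otherwise there are
matrices A with phi(A) near 1 for which A E_ab A^-1 is arbitrarily large: det A = 1 makes A
bounded as soon as its adjoint action is. Choosing a scalar s tending to 0 such that s A E_ab A^-1
stays bounded and away from 0, the elements A (1 + s E_ab) A^-1 accumulate at a nontrivial
transvection in the kernel of phi, whose normal closure is the whole of SL(n,F); so H is trivial.
The scaling uses a topologically nilpotent element and a compact neighbourhood of 0 that it maps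
into itself, so no absolute value is needed.
*)

theory Submission
  imports Defs
begin

section \<open>Local fields\<close>

text \<open>The class \<open>local_field\<close> is purely topological, so size is measured by a
  compact neighbourhood V of 0 with t V inside V: x is bounded at level k when t^k x lies in V, and
  V minus t (interior V) serves as a sphere, compact and away from 0. Quotients of SL need no
  separate treatment because the topology on the target of phi is arbitrary: a coarser group
  topology on SL/N keeps the projection continuous, and once the projection is a quotient map it
  determines that topology. For quotients of PSL the two projections are composed. Accumulation is
  expressed by closedness: the X of rank one and square zero on the sphere form a compact set, so
  the image of all 1 + X in the Hausdorff group H is closed, and it suffices that it meets every
  neighbourhood of 1. The characteristic enters at one place. Diagonal conjugation rescales an
  elementary matrix by squares only, and differences of squares fill the field once 2 is
  invertible.\<close>

lemma mult_continuous_nhds: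
  fixes a b :: "'a::topological_semigroup_mult"
  assumes "open S" "a * b \<in> S"
  obtains A B where "open A" "open B" "a \<in> A" "b \<in> B" "\<And>x y. x \<in> A \<Longrightarrow> y \<in> B \<Longrightarrow> x * y \<in> S"
proof -
  have "continuous_on UNIV (\<lambda>p::'a \<times> 'a. fst p * snd p)"
    by (intro continuous_intros)
  then have "open ((\<lambda>p. fst p * snd p) -` S)"
    using assms(1) by (simp add: open_vimage)
  moreover have "(a, b) \<in> (\<lambda>p. fst p * snd p) -` S"
    using assms(2) by simp
  ultimately obtain A B where "open A" "open B" "(a, b) \<in> A \<times> B" "A \<times> B \<subseteq> (\<lambda>p. fst p * snd p) -` S"
    by (rule open_prod_elim)
  then show ?thesis
    using that[of A B] by fastforce
qed

text \<open>A tube-lemma argument. It replaces the estimate that a small scalar times a bounded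
  element is small.\<close>

lemma nhds_0_mult_compact:
  fixes K S :: "'a::topological_field set"
  assumes K: "compact K" and S: "open S" "0 \<in> S"
  obtains U where "open U" "0 \<in> U" "\<And>u x. u \<in> U \<Longrightarrow> x \<in> K \<Longrightarrow> u * x \<in> S"
proof -
  have "\<exists>A B. open A \<and> open B \<and> 0 \<in> A \<and> x \<in> B \<and> (\<forall>u\<in>A. \<forall>y\<in>B. u * y \<in> S)" for x
    using mult_continuous_nhds[of S 0 x] S by (metis mult_zero_left)
  then obtain A B where AB: "\<And>x. open (A x)" "\<And>x. open (B x)" "\<And>x. 0 \<in> A x" "\<And>x. x \<in> B x"
      "\<And>x u y. u \<in> A x \<Longrightarrow> y \<in> B x \<Longrightarrow> u * y \<in> S"
    by metis
  have "K \<subseteq> (\<Union>x\<in>K. B x)"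
    using AB(4) by blast
  then obtain C where C: "C \<subseteq> K" "finite C" "K \<subseteq> (\<Union>x\<in>C. B x)"
    using compactE_image[OF K, of K B] AB(2) by metis
  show ?thesis
  proof
    show "open (\<Inter>x\<in>C. A x)"
      using C AB by (intro open_INT) auto
    show "0 \<in> (\<Inter>x\<in>C. A x)"
      using AB by blast
    show "u * x \<in> S" if "u \<in> (\<Inter>x\<in>C. A x)" "x \<in> K" for u x
      using that C AB(5) by blast
  qed
qed

lemma continuous_on_inverse_field [continuous_intros]:
  fixes f :: "_ \<Rightarrow> 'a::topological_field"
  assumes "continuous_on S f" "\<And>x. x \<in> S \<Longrightarrow> f x \<noteq> 0"
  shows "continuous_on S (\<lambda>x. inverse (f x))"
  using assms unfolding continuous_on_def
  by (metis filterlim_compose tendsto_inverse_nhds)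

text \<open>If {0} were open, translation would make every point open and the field
  discrete.\<close>

lemma open_contains_nonzero:
  fixes U :: "'a::local_field set"
  assumes "open U" "0 \<in> U"
  shows "\<exists>t\<in>U. t \<noteq> 0"
proof (rule ccontr)
  assume "\<not> ?thesis"
  then have U: "U = {0}"
    using assms by auto
  have "open S" for S :: "'a set"
  proof -
    have "open ((\<lambda>y. y - x) -` U)" for x
      by (intro open_vimage assms continuous_intros)
    moreover have "(\<lambda>y. y - x) -` U = {x}" for x
      using U by auto
    ultimately have "open (\<Union>x\<in>S. {x})"
      by (intro open_UN) metis
    then show ?thesis by simp
  qed
  then show False
    using nondiscrete by blast
qed

section \<open>Topological nilpotence and boundedness\<close>

text \<open>If t^n and t^m with m > n are both close to y, their quotient t^(m-n) is close to y/y =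
  1. This rules out nonzero cluster points for a t whose positive powers stay away from 1.\<close>

lemma power_cluster_point_1:
  fixes t :: "'a::topological_field"
  assumes "y \<noteq> 0" "t \<noteq> 0" and freq: "\<And>P. open P \<Longrightarrow> y \<in> P \<Longrightarrow> (\<exists>\<^sub>F n in sequentially. t ^ n \<in> P)"
    and "open S" "1 \<in> S"
  shows "\<exists>n\<ge>1. t ^ n \<in> S"
proof -
  have "y * inverse y \<in> S"
    using assms by simp
  then obtain A B where AB: "open A" "open B" "y \<in> A" "inverse y \<in> B"
      "\<And>x z. x \<in> A \<Longrightarrow> z \<in> B \<Longrightarrow> x * z \<in> S"
    using mult_continuous_nhds[OF \<open>open S\<close>] by metis
  have "eventually (\<lambda>x. inverse x \<in> B) (nhds y)"
    using tendsto_inverse_nhds[OF \<open>y \<noteq> 0\<close>] AB(2,4) by (auto simp: tendsto_def)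
  then obtain C where C: "open C" "y \<in> C" "\<And>x. x \<in> C \<Longrightarrow> inverse x \<in> B"
    unfolding eventually_nhds by blast
  obtain n where n: "t ^ n \<in> A \<inter> C"
    using freq[of "A \<inter> C"] AB C frequently_ex by blast
  obtain m where m: "m > n" "t ^ m \<in> A \<inter> C"
    using freq[of "A \<inter> C"] AB C unfolding frequently_sequentially
    by (metis IntI Suc_le_lessD open_Int)
  have "t ^ m * inverse (t ^ n) \<in> S"
    using AB(5) C(3) n m by blast
  moreover have "t ^ m * inverse (t ^ n) = t ^ (m - n)"
    using m \<open>t \<noteq> 0\<close> by (simp add: power_diff divide_inverse)
  ultimately show ?thesis
    using m by (intro exI[of _ "m - n"]) auto
qed

text \<open>Any nonzero t in V with t V inside V works, provided V misses 1: its positive powers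
  stay in the compact V, so they have a cluster point, which can only be 0.\<close>

lemma local_field_topologically_nilpotent:
  obtains t :: "'a::local_field" and V
  where "t \<noteq> 0" "compact V" "0 \<in> interior V" "\<And>x. x \<in> V \<Longrightarrow> t * x \<in> V" "(\<lambda>n. t ^ n) \<longlonglongrightarrow> 0"
proof -
  obtain U0 K where K: "open U0" "compact K" "(0::'a) \<in> U0" "U0 \<subseteq> K"
    using locally_compact[of 0] by (elim exE conjE) (rule that)
  obtain A B where AB: "open A" "open B" "(0::'a) \<in> A" "1 \<in> B" "A \<inter> B = {}"
    using hausdorff[of "0::'a" 1] by auto
  \<comment> \<open>Removing a neighbourhood of 1 keeps V a compact neighbourhood of 0, and makes
    the complement of V an open set around 1 that no positive power of t enters.\<close>
  define V where "V = K - B"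
  have V: "compact V" "1 \<notin> V"
    unfolding V_def using K AB by (auto intro: compact_diff)
  have "U0 \<inter> A \<subseteq> V"
    using K AB by (auto simp: V_def)
  then have V0: "0 \<in> interior V"
    using K AB by (meson IntI interiorI open_Int)
  obtain U where U: "open U" "0 \<in> U" "\<And>u x. u \<in> U \<Longrightarrow> x \<in> V \<Longrightarrow> u * x \<in> interior V"
    using nhds_0_mult_compact[OF V(1) open_interior V0] by blast
  obtain t where t: "t \<in> U" "t \<in> interior V" "t \<noteq> 0"
    using open_contains_nonzero[of "U \<inter> interior V"] U V0 by blast
  have tV: "t * x \<in> V" if "x \<in> V" for x
    using U(3)[OF t(1) that] interior_subset by blast
  have pow: "t ^ Suc n \<in> V" for n
    by (induction n) (use t interior_subset tV in \<open>auto\<close>)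
  have "filtermap (\<lambda>n. t ^ n) sequentially \<noteq> bot"
    by (simp add: filtermap_bot_iff)
  moreover have "eventually (\<lambda>x. x \<in> V) (filtermap (\<lambda>n. t ^ n) sequentially)"
    unfolding eventually_filtermap eventually_sequentially
    using pow by (metis Suc_le_D One_nat_def)
  ultimately obtain y where y: "y \<in> V" "inf (nhds y) (filtermap (\<lambda>n. t ^ n) sequentially) \<noteq> bot"
    using V(1) unfolding compact_filter by blast
  have freq: "\<exists>\<^sub>F n in sequentially. t ^ n \<in> P" if P: "open P" "y \<in> P" for P
  proof (rule ccontr)
    assume "\<not> ?thesis"
    then have "eventually (\<lambda>x. x \<notin> P) (filtermap (\<lambda>n. t ^ n) sequentially)"
      by (simp add: frequently_def eventually_filtermap)
    moreover have "eventually (\<lambda>x. x \<in> P) (nhds y)"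
      using P by (rule eventually_nhds_in_open)
    ultimately have "eventually (\<lambda>x. False) (inf (nhds y) (filtermap (\<lambda>n. t ^ n) sequentially))"
      unfolding eventually_inf by blast
    then show False
      using y(2) by (simp add: eventually_False)
  qed
  have "y = 0"
  proof (rule ccontr)
    assume "y \<noteq> 0"
    moreover have "open (- V)" "1 \<in> - V"
      using V compact_imp_closed by auto
    ultimately obtain n where "n \<ge> 1" "t ^ n \<in> - V"
      using power_cluster_point_1[OF _ t(3) freq] by blast
    then show False
      using pow[of "n - 1"] by simp
  qed
  have "(\<lambda>n. t ^ n) \<longlonglongrightarrow> 0"
  proof (rule topological_tendstoI)
    fix S :: "'a set" assume "open S" "0 \<in> S"
    then obtain U' where U': "open U'" "0 \<in> U'" "\<And>u x. u \<in> U' \<Longrightarrow> x \<in> V \<Longrightarrow> u * x \<in> S"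
      using nhds_0_mult_compact[OF V(1)] by blast
    obtain n where n: "t ^ n \<in> U'"
      using freq[of U'] U' \<open>y = 0\<close> frequently_ex by blast
    \<comment> \<open>One power near 0 drags all later ones along, as t^m is t^n times an element of
      V. The bound is strict because t^0 = 1 is not in V.\<close>
    have "t ^ m \<in> S" if "m \<ge> Suc n" for m
    proof -
      obtain k where "m = n + Suc k"
        using \<open>m \<ge> Suc n\<close> by (metis add_Suc_shift le_Suc_ex)
      then show ?thesis
        using U'(3)[OF n pow[of k]] by (simp only: power_add)
    qed
    then show "eventually (\<lambda>m. t ^ m \<in> S) sequentially"
      unfolding eventually_sequentially by blast
  qed
  then show ?thesis
    using that t(3) V V0 tV by blast
qed

lemma compact_mult:
  fixes A B :: "'a::topological_semigroup_mult set"
  assumes "compact A" "compact B"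
  shows "compact ((\<lambda>(x, y). x * y) ` (A \<times> B))"
  unfolding case_prod_unfold
  by (intro compact_continuous_image compact_Times assms continuous_intros)

text \<open>B plays the closed unit ball. For x outside V take the least k with t^k x in V; then t^k
  x lies on the sphere V - S, whose inverses form a compact set, and x^-1 = t^k (t^k x)^-1 with the
  powers of t bounded.\<close>

lemma compact_inverse_dichotomy:
  obtains B :: "'a::local_field set"
  where "compact B" "\<And>x. x \<in> B \<or> inverse x \<in> B"
proof -
  obtain t :: 'a and V where t: "t \<noteq> 0" "compact V" "0 \<in> interior V" "\<And>x. x \<in> V \<Longrightarrow> t * x \<in> V"
      "(\<lambda>n. t ^ n) \<longlonglongrightarrow> 0"
    by (rule local_field_topologically_nilpotent) blast
  obtain s :: nat where s: "\<And>n. n \<ge> s \<Longrightarrow> t ^ n \<in> V"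
    using topological_tendstoD[OF t(5) open_interior t(3)] interior_subset
    unfolding eventually_sequentially by blast
  \<comment> \<open>S is t (interior V): by minimality of k, the element t^k x avoids it.\<close>
  define S where "S = (\<lambda>x. inverse t * x) -` interior V"
  have S: "open S" "0 \<in> S"
    unfolding S_def using t(3) by (auto intro!: open_vimage continuous_intros)
  define B where "B = V \<union> (\<lambda>(x, y). x * y) ` ((V \<union> (\<lambda>n. t ^ n) ` {..s}) \<times> inverse ` (V - S))"
  have "compact (inverse ` (V - S))"
    using S(2) by (intro compact_continuous_image compact_diff t S continuous_intros) auto
  moreover have "compact (V \<union> (\<lambda>n. t ^ n) ` {..s})"
    by (rule compact_Un[OF t(2) finite_imp_compact]) simp
  ultimately have "compact B"
    unfolding B_def by (rule compact_Un[OF t(2) compact_mult, rotated])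
  moreover have "inverse x \<in> B" if "x \<notin> V" for x
  proof -
    have "(\<lambda>n. t ^ n * x) \<longlonglongrightarrow> 0 * x"
      by (intro tendsto_intros t)
    then have "eventually (\<lambda>n. t ^ n * x \<in> interior V) sequentially"
      using topological_tendstoD[OF _ open_interior] t(3) by force
    then obtain n where "t ^ n * x \<in> V"
      using interior_subset unfolding eventually_sequentially by blast
    then obtain k where k: "t ^ k * x \<in> V" "\<And>j. j < k \<Longrightarrow> t ^ j * x \<notin> V"
      using exists_least_iff[of "\<lambda>n. t ^ n * x \<in> V"] by blast
    have "k \<noteq> 0"
      using k(1) that by (metis mult_1 power_0)
    then obtain j where j: "k = Suc j"
      using not0_implies_Suc by blast
    have "t ^ k * x \<notin> S"
      using k(2)[of j] j t(1) interior_subset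
      by (auto simp: S_def mult.assoc[symmetric])
    then have "inverse (t ^ k * x) \<in> inverse ` (V - S)"
      using k by blast
    moreover have "t ^ k \<in> V \<union> (\<lambda>n. t ^ n) ` {..s}"
      using s[of k] by (cases "k \<le> s") auto
    ultimately have "t ^ k * inverse (t ^ k * x) \<in> B"
      unfolding B_def by blast
    moreover have "t ^ k * inverse (t ^ k * x) = inverse x"
      using t(1) by (simp add: field_simps)
    ultimately show ?thesis by (simp only:)
  qed
  moreover have "V \<subseteq> B"
    by (simp add: B_def)
  ultimately show ?thesis
    using that by blast
qed

text \<open>Either x itself is in the ball B, or x^-1 is, and then x = x^n (x^-1)^(n-1) is a product
  of bounded factors.\<close>

lemma compact_power_preimage:
  fixes C :: "'a::local_field set"
  assumes "compact C" "n \<ge> 1"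
  obtains D where "compact D" "\<And>x. x ^ n \<in> C \<Longrightarrow> x \<in> D"
proof -
  obtain B :: "'a set" where B: "compact B" "\<And>x. x \<in> B \<or> inverse x \<in> B"
    by (rule compact_inverse_dichotomy) blast
  define D where "D = B \<union> (\<lambda>(x, y). x * y) ` (C \<times> (\<lambda>x. x ^ (n - 1)) ` B)"
  have "compact ((\<lambda>x. x ^ (n - 1)) ` B)"
    by (intro compact_continuous_image B continuous_intros)
  then have "compact D"
    unfolding D_def by (intro compact_Un compact_mult assms B)
  moreover have "x \<in> D" if "x ^ n \<in> C" for x
  proof (cases "x \<in> B")
    case False
    then have "inverse x \<in> B" using B by blast
    then have "x ^ n * inverse x ^ (n - 1) \<in> D"
      using that by (auto simp: D_def)
    moreover have "x ^ n * inverse x ^ (n - 1) = x"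
    proof (cases "x = 0")
      case False
      have "x ^ n = x * x ^ (n - 1)"
        using assms(2) by (metis One_nat_def Suc_pred less_eq_Suc_le power_Suc)
      then show ?thesis
        using False by (simp add: field_simps)
    qed (use assms in simp)
    ultimately show ?thesis by simp
  qed (simp add: D_def)
  ultimately show ?thesis
    using that by blast
qed

section \<open>Transvections\<close>

lemma carrier_SL: "A \<in> carrier SL \<longleftrightarrow> det A = 1"
  and mult_SL: "A \<otimes>\<^bsub>SL\<^esub> B = A ** B"
  and one_SL: "\<one>\<^bsub>SL\<^esub> = mat 1"
  by (simp_all add: SL_def)

lemma det_right_inverse_1:
  fixes A B :: "'a::comm_ring_1^'n^'n"
  assumes "det A = 1" "A ** B = mat 1"
  shows "det B = 1"
  using assms by (metis det_I det_mul mult_1)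

lemma group_SL: "group (SL :: ('a::field^'n^'n) monoid)"
proof (rule groupI)
  fix A :: "'a^'n^'n" assume "A \<in> carrier SL"
  then have "det A = 1" by (simp add: carrier_SL)
  then have "invertible A" by (simp add: invertible_det_nz)
  then obtain B where B: "A ** B = mat 1" "B ** A = mat 1"
    unfolding invertible_def by blast
  then show "\<exists>B\<in>carrier SL. B \<otimes>\<^bsub>SL\<^esub> A = \<one>\<^bsub>SL\<^esub>"
    using det_right_inverse_1[OF \<open>det A = 1\<close>] by (auto simp: carrier_SL mult_SL one_SL)
qed (simp_all add: carrier_SL mult_SL one_SL det_mul det_I matrix_mul_assoc)

lemma inv_SL:
  fixes A B :: "'a::field^'n^'n"
  assumes "det A = 1" "A ** B = mat 1"
  shows "inv\<^bsub>SL\<^esub> A = B"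
proof -
  interpret group "SL :: ('a^'n^'n) monoid" by (rule group_SL)
  show ?thesis
    by (rule inv_equality)
      (use assms det_right_inverse_1[OF assms] matrix_left_right_inverse in
        \<open>auto simp: carrier_SL mult_SL one_SL\<close>)
qed

lemma SL_right_inverse:
  fixes A :: "'a::field^'n^'n"
  assumes "det A = 1"
  shows "A ** inv\<^bsub>SL\<^esub> A = mat 1"
  using group.r_inv[OF group_SL, of A] assms by (simp add: carrier_SL mult_SL one_SL)

lemma matrix_add_rdistrib: "(A + B) ** C = A ** C + B ** C"
  by (simp add: vec_eq_iff matrix_matrix_mult_def algebra_simps sum.distrib)

lemma matrix_right_inverse_mult:
  fixes A B C D :: "'a::semiring_1^'n^'n"
  assumes "A ** B = mat 1" "C ** D = mat 1"
  shows "(C ** A) ** (B ** D) = mat 1"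
proof -
  have "(C ** A) ** (B ** D) = C ** (A ** B) ** D"
    by (simp add: matrix_mul_assoc)
  then show ?thesis
    by (simp add: assms)
qed

section \<open>Rank-one matrices and transvections\<close>

definition dot :: "'a::comm_ring_1^'n \<Rightarrow> 'a^'n \<Rightarrow> 'a" where
  "dot z u = (\<Sum>i\<in>UNIV. z $ i * u $ i)"

definition outer :: "'a::comm_ring_1^'m \<Rightarrow> 'a^'n \<Rightarrow> 'a^'n^'m" where
  "outer u z = (\<chi> i j. u $ i * z $ j)"

text \<open>Vector u and covector z are separate arguments because conjugation acts on them
  separately. It is a transvection in the usual sense when \<open>dot z u = 0\<close>, a condition
  left to the lemmas.\<close>

definition transvection :: "'a::comm_ring_1^'n \<Rightarrow> 'a^'n \<Rightarrow> 'a^'n^'n" where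
  "transvection u z = mat 1 + outer u z"

lemma dot_simps [simp]:
  "dot z (u + v) = dot z u + dot z v" "dot (z + w) u = dot z u + dot w u"
  "dot z (u - v) = dot z u - dot z v" "dot (z - w) u = dot z u - dot w u"
  "dot z (c *s u) = c * dot z u" "dot (c *s z) u = c * dot z u"
  "dot z (- u) = - dot z u" "dot (- z) u = - dot z u"
  "dot z 0 = 0" "dot 0 u = 0"
  by (simp_all add: dot_def algebra_simps sum.distrib sum_distrib_left sum_subtractf sum_negf)

lemma axis_nth_if: "axis k c $ i = (if i = k then c else 0)"
  by (simp add: axis_def)

lemma dot_axis [simp]: "dot (axis k 1) u = u $ k" "dot u (axis k 1) = u $ k"
  by (simp_all add: dot_def axis_nth_if if_distrib[of "\<lambda>x. x * _"] if_distrib[of "\<lambda>x. _ * x"]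
      cong: if_cong)

lemma matrix_mult_outer: "A ** outer u z = outer (A *v u) z"
  by (simp add: vec_eq_iff outer_def matrix_matrix_mult_def matrix_vector_mult_def sum_distrib_right
      mult.assoc)

lemma outer_matrix_mult: "outer u z ** A = outer u (z v* A)"
  by (simp add: vec_eq_iff outer_def matrix_matrix_mult_def vector_matrix_mult_def sum_distrib_left
      mult_ac)

lemma outer_mult_vector: "outer u z *v x = dot z x *s u"
  by (simp add: vec_eq_iff outer_def matrix_vector_mult_def dot_def sum_distrib_left mult_ac)

lemma vector_mult_outer: "x v* outer u z = dot x u *s z"
  by (simp add: vec_eq_iff outer_def vector_matrix_mult_def dot_def sum_distrib_left sum_distrib_right mult_ac)

lemma transvection_mult_vector: "transvection u z *v x = x + dot z x *s u"
  by (simp add: transvection_def matrix_vector_mult_add_rdistrib outer_mult_vector)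

lemma vector_mult_transvection: "x v* transvection u z = x + dot x u *s z"
  by (simp add: transvection_def vector_matrix_mult_add_rdistrib vector_mult_outer)

lemma dot_vector_matrix: "dot (z v* A) u = dot z (A *v u)"
  unfolding dot_def vector_matrix_mult_def matrix_vector_mult_def
  by (simp add: sum_distrib_left sum_distrib_right, subst sum.swap) (simp add: mult_ac)

lemma transvection_conj:
  assumes "A ** B = mat 1"
  shows "A ** transvection u z ** B = transvection (A *v u) (z v* B)"
  by (simp add: transvection_def matrix_add_ldistrib matrix_add_rdistrib assms
      matrix_mult_outer outer_matrix_mult)

lemma outer_zero [simp]: "outer 0 z = 0" "outer u 0 = 0"
  by (simp_all add: outer_def vec_eq_iff)

lemma outer_scaleL: "outer (c *s u) z = outer u (c *s z)"
  by (simp add: outer_def vec_eq_iff mult_ac)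

lemma transvection_scaleL: "transvection (c *s u) z = transvection u (c *s z)"
  by (simp add: transvection_def outer_scaleL)

lemma transvection_zero [simp]: "transvection 0 z = mat 1" "transvection u 0 = mat 1"
  by (simp_all add: transvection_def)

lemma transvection_mult:
  assumes "dot z v = 0"
  shows "transvection u z ** transvection v z = transvection (u + v) z"
proof -
  have "transvection u z ** transvection v z = transvection u z + outer (transvection u z *v v) z"
    by (subst (2) transvection_def) (simp add: matrix_add_ldistrib matrix_mult_outer)
  also have "\<dots> = transvection (u + v) z"
    using assms
    by (simp add: transvection_mult_vector) (simp add: transvection_def outer_def vec_eq_iff algebra_simps)
  finally show ?thesis .
qed

lemma transvection_inverse:
  assumes "dot z u = 0"
  shows "transvection u z ** transvection (- u) z = mat 1"
  using assms by (subst transvection_mult) auto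

text \<open>Only column a of the identity is changed, so this is an instance of the determinant
  identity behind Cramer's rule.\<close>

lemma det_transvection_axis:
  fixes u :: "'a::field^'n"
  shows "det (transvection u (axis a 1)) = 1 + u $ a"
proof -
  have "transvection u (axis a 1)
      = (\<chi> i j. if j = a then (mat 1 *v (u + axis a 1)) $ i else mat 1 $ i $ j)"
    unfolding matrix_vector_mul_lid
    by (auto simp: vec_eq_iff transvection_def outer_def mat_def axis_nth_if)
  then show ?thesis
    by (simp only: cramer_lemma) (simp add: axis_nth_if det_I)
qed

lemma transpose_transvection: "transpose (transvection u z) = transvection z u"
  by (auto simp: vec_eq_iff transpose_def transvection_def outer_def mat_def mult.commute)

text \<open>A conjugation moves u to a multiple of a basis vector; transposing then puts that vector
  into the covector slot, where the previous determinant formula applies.\<close>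

lemma det_transvection:
  fixes u z :: "'a::field^'n"
  assumes "dot z u = 0"
  shows "det (transvection u z) = 1"
proof (cases "u = 0")
  case False
  then obtain a where a: "u $ a \<noteq> 0"
    by (auto simp: vec_eq_iff)
  \<comment> \<open>Chosen so that \<open>?P\<close> sends u to u + u_a p = u_a e_a, while p_a = 0
    makes \<open>?P\<close> invertible with inverse \<open>?Q\<close>.\<close>
  define p where "p = axis a 1 - inverse (u $ a) *s u"
  have pa: "p $ a = 0"
    using a by (simp add: p_def axis_nth_if)
  let ?P = "transvection p (axis a 1)" and ?Q = "transvection (- p) (axis a 1)"
  have PQ: "?P ** ?Q = mat 1"
    using pa by (intro transvection_inverse) simp
  have Pu: "?P *v u = u $ a *s axis a 1"
    using a by (simp add: transvection_mult_vector p_def vec_eq_iff axis_nth_if field_simps)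
  have Q: "?Q ** ?P = mat 1"
    using PQ matrix_left_right_inverse by blast
  have "dot (z v* ?Q) (u $ a *s axis a 1) = dot z u"
    unfolding Pu[symmetric] dot_vector_matrix by (simp add: matrix_vector_mul_assoc Q)
  then have z: "u $ a * (z v* ?Q) $ a = 0"
    using assms by simp
  have "det (?P ** transvection u z ** ?Q) = det (transvection (u $ a *s axis a 1) (z v* ?Q))"
    by (simp add: transvection_conj[OF PQ] Pu)
  also have "\<dots> = det (transvection (u $ a *s (z v* ?Q)) (axis a 1))"
    by (subst det_transpose[symmetric]) (simp add: transpose_transvection transvection_scaleL)
  also have "\<dots> = 1"
    using z by (simp add: det_transvection_axis)
  finally show ?thesis
    using pa by (simp add: det_mul det_transvection_axis)
qed (simp add: det_I)

text \<open>Conjugation by transvections clears first the vector, then the covector.\<close>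
lemma transvection_conj_elementary:
  fixes u z :: "'a::field^'n"
  assumes "u \<noteq> 0" "z \<noteq> 0" "dot z u = 0"
  obtains P Q a b c where "det P = 1" "P ** Q = mat 1" "a \<noteq> b" "c \<noteq> 0"
    "P ** transvection u z ** Q = transvection (c *s axis a 1) (axis b 1)"
proof -
  obtain a where a: "u $ a \<noteq> 0"
    using assms(1) by (auto simp: vec_eq_iff)
  define p where "p = axis a 1 - inverse (u $ a) *s u"
  have pa: "p $ a = 0"
    using a by (simp add: p_def axis_nth_if)
  let ?P = "transvection p (axis a 1)" and ?Q = "transvection (- p) (axis a 1)"
  have PQ: "?P ** ?Q = mat 1"
    using pa by (intro transvection_inverse) simp
  have Pu: "?P *v u = u $ a *s axis a 1"
    using a by (simp add: transvection_mult_vector p_def vec_eq_iff axis_nth_if field_simps)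
  have QP: "?Q ** ?P = mat 1"
    using PQ matrix_left_right_inverse by blast
  define z1 where "z1 = z v* ?Q"
  have "dot z1 (u $ a *s axis a 1) = dot z u"
    unfolding Pu[symmetric] z1_def dot_vector_matrix by (simp add: matrix_vector_mul_assoc QP)
  then have z1a: "z1 $ a = 0"
    using assms a by simp
  have "z1 v* ?P = z"
    unfolding z1_def vector_matrix_mul_assoc QP by simp
  then have "z1 \<noteq> 0"
    using assms(2) by (metis vector_matrix_mult_0)
  then obtain b where b: "z1 $ b \<noteq> 0"
    by (auto simp: vec_eq_iff)
  have ab: "a \<noteq> b"
    using b z1a by metis
  \<comment> \<open>Dual choice to p: z1 + z1_b y = z1_b e_b. Since y_a = 0, the matrix
    \<open>?P2\<close> fixes e_a, so the vector already cleared is not disturbed.\<close>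
  define y where "y = axis b 1 - inverse (z1 $ b) *s z1"
  have y: "y $ b = 0" "y $ a = 0"
    using b ab z1a by (simp_all add: y_def axis_nth_if)
  let ?P2 = "transvection (- axis b 1) y" and ?Q2 = "transvection (axis b 1) y"
  have PQ2: "?P2 ** ?Q2 = mat 1"
    using transvection_inverse[of y "- axis b 1"] y by simp
  have zQ: "z1 v* ?Q2 = z1 $ b *s axis b 1"
    using b by (simp add: vector_mult_transvection y_def vec_eq_iff axis_nth_if field_simps)
  have PQ': "(?P2 ** ?P) ** (?Q ** ?Q2) = mat 1"
    by (rule matrix_right_inverse_mult[OF PQ PQ2])
  show ?thesis
  proof
    show "det (?P2 ** ?P) = 1"
      unfolding det_mul using pa y by (simp add: det_transvection)
    show "(?P2 ** ?P) ** (?Q ** ?Q2) = mat 1"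
      by (rule PQ')
    have "?P2 *v (u $ a *s axis a 1) = u $ a *s axis a 1"
      using y by (simp add: transvection_mult_vector)
    then have "(?P2 ** ?P) *v u = u $ a *s axis a 1"
      by (simp add: matrix_vector_mul_assoc[symmetric] Pu)
    moreover have "z v* (?Q ** ?Q2) = z1 $ b *s axis b 1"
      by (simp add: vector_matrix_mul_assoc[symmetric] z1_def[symmetric] zQ)
    ultimately show "(?P2 ** ?P) ** transvection u z ** (?Q ** ?Q2)
        = transvection ((z1 $ b * u $ a) *s axis a 1) (axis b 1)"
      unfolding transvection_conj[OF PQ'] by (simp add: transvection_scaleL mult.commute)
    show "a \<noteq> b" by fact
    show "z1 $ b * u $ a \<noteq> 0" using a b by simp
  qed
qed

text \<open>The classical product (1 - E_mn)(1 + E_nm)(1 - E_mn). One sign is needed because a plain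
  transposition matrix has determinant -1.\<close>

lemma signed_transposition:
  fixes m n :: "'n::finite"
  assumes "m \<noteq> n"
  obtains P Q :: "'a::field^'n^'n" where "det P = 1" "P ** Q = mat 1"
    "\<And>k. P *v axis k 1 = (if k = n then -1 else 1) *s axis (Transposition.transpose m n k) 1"
    "\<And>k. axis k 1 v* Q = (if k = n then -1 else 1) *s axis (Transposition.transpose m n k) 1"
proof -
  let ?A = "transvection (- axis m 1) (axis n 1) :: 'a^'n^'n"
  let ?A' = "transvection (axis m 1) (axis n 1) :: 'a^'n^'n"
  let ?B = "transvection (axis n 1) (axis m 1) :: 'a^'n^'n"
  let ?B' = "transvection (- axis n 1) (axis m 1) :: 'a^'n^'n"
  have A: "?A ** ?A' = mat 1" and B: "?B ** ?B' = mat 1"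
    using transvection_inverse[of "axis n 1" "- axis m 1"]
      transvection_inverse[of "axis m 1" "axis n 1"] assms
    by (simp_all add: axis_nth_if)
  show ?thesis
  proof
    show "det (?A ** ?B ** ?A) = 1"
      using assms by (simp add: det_mul det_transvection axis_nth_if)
    show "(?A ** ?B ** ?A) ** (?A' ** ?B' ** ?A') = mat 1"
      using matrix_right_inverse_mult[OF A matrix_right_inverse_mult[OF B A]]
      by (simp only: matrix_mul_assoc)
    show "(?A ** ?B ** ?A) *v axis k 1
        = (if k = n then -1 else 1) *s axis (Transposition.transpose m n k) 1" for k
      using assms
      by (simp add: matrix_vector_mul_assoc[symmetric] transvection_mult_vector axis_nth_if
          vec_eq_iff axis_nth_if Transposition.transpose_def)
    show "axis k 1 v* (?A' ** ?B' ** ?A')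
        = (if k = n then -1 else 1) *s axis (Transposition.transpose m n k) 1" for k
      using assms
      by (simp add: vector_matrix_mul_assoc[symmetric] vector_mult_transvection axis_nth_if
          vec_eq_iff axis_nth_if Transposition.transpose_def)
  qed
qed

section \<open>Normal subgroups of the special linear group containing a transvection\<close>

context
  fixes N :: "('a::field^'n^'n) set"
  assumes N: "N \<lhd> SL"
begin

lemma normal_SL_det: "A \<in> N \<Longrightarrow> det A = 1"
  using normal_imp_subgroup[OF N] subgroup.subset carrier_SL by blast

lemma normal_SL_mult: "A \<in> N \<Longrightarrow> B \<in> N \<Longrightarrow> A ** B \<in> N"
  using subgroup.m_closed[OF normal_imp_subgroup[OF N]] by (simp add: mult_SL)

lemma normal_SL_one: "mat 1 \<in> N"
  using subgroup.one_closed[OF normal_imp_subgroup[OF N]] by (simp add: one_SL)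

lemma normal_SL_inverse: "A \<in> N \<Longrightarrow> A ** B = mat 1 \<Longrightarrow> B \<in> N"
  using subgroup.m_inv_closed[OF normal_imp_subgroup[OF N], of A] inv_SL[of A B] normal_SL_det
  by metis

lemma normal_SL_conj: "A \<in> N \<Longrightarrow> det P = 1 \<Longrightarrow> P ** Q = mat 1 \<Longrightarrow> P ** A ** Q \<in> N"
  using normal.inv_op_closed2[OF N, of P A] inv_SL[of P Q]
  by (simp add: carrier_SL mult_SL)

lemma normal_SL_conj_iff:
  assumes "det P = 1" "P ** Q = mat 1"
  shows "P ** A ** Q \<in> N \<longleftrightarrow> A \<in> N"
proof
  assume "P ** A ** Q \<in> N"
  have QP: "Q ** P = mat 1"
    using assms(2) matrix_left_right_inverse by blast
  have "Q ** (P ** A ** Q) ** P \<in> N"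
    by (rule normal_SL_conj) (fact, rule det_right_inverse_1[OF assms], fact)
  moreover have "Q ** (P ** A ** Q) ** P = (Q ** P) ** A ** (Q ** P)"
    by (simp add: matrix_mul_assoc)
  ultimately show "A \<in> N"
    by (simp add: QP)
qed (use assms normal_SL_conj in blast)

text \<open>Conjugating by the diagonal matrix with entries \<open>d\<close> and \<open>1/d\<close> multiplies the
  parameter of the elementary matrix by \<open>d\<^sup>2\<close>; every element of the field is a difference of squares.\<close>
lemma normal_SL_root_group:
  assumes ab: "a \<noteq> b" and c: "c \<noteq> 0" "transvection (c *s axis a 1) (axis b 1) \<in> N"
    and two: "(2::'a) \<noteq> 0"
  shows "transvection (e *s axis a 1) (axis b 1) \<in> N"
proof -
  have sq: "transvection ((c * d\<^sup>2) *s axis a 1) (axis b 1) \<in> N" for d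
  proof (cases "d = 0")
    case False
    \<comment> \<open>Two conditional factors rather than one nested conditional, so that the
      determinant splits into a product for a and a product for b.\<close>
    let ?f = "\<lambda>d i. (if i = a then d else 1) * (if i = b then inverse d else 1)"
    let ?D = "\<lambda>d. (\<chi> i j. if i = j then ?f d i else 0) :: 'a^'n^'n"
    have "det (?D d) = (\<Prod>i\<in>UNIV. ?f d i)"
      by (subst det_diagonal) simp_all
    also have "\<dots> = 1"
      using False by (simp add: prod.distrib)
    finally have det: "det (?D d) = 1" .
    have inv: "?D d ** ?D (inverse d) = mat 1"
      using False ab
      by (auto simp: vec_eq_iff matrix_matrix_mult_def mat_def if_distrib[of "\<lambda>x. _ * x"]
          if_distrib[of "\<lambda>x. x * _"] cong: if_cong)
    have "?D d *v (c *s axis a 1) = d *s (c *s axis a 1)"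
      using ab by (auto simp: vec_eq_iff matrix_vector_mult_def axis_nth_if if_distrib[of "\<lambda>x. _ * x"]
          if_distrib[of "\<lambda>x. x * _"] cong: if_cong)
    moreover have "axis b 1 v* ?D (inverse d) = d *s axis b 1"
      using ab by (auto simp: vec_eq_iff vector_matrix_mult_def axis_nth_if if_distrib[of "\<lambda>x. _ * x"]
          if_distrib[of "\<lambda>x. x * _"] cong: if_cong)
    ultimately have "?D d ** transvection (c *s axis a 1) (axis b 1) ** ?D (inverse d)
        = transvection ((c * d\<^sup>2) *s axis a 1) (axis b 1)"
      unfolding transvection_conj[OF inv]
      by (simp add: transvection_scaleL[symmetric] power2_eq_square mult_ac)
    then show ?thesis
      using normal_SL_conj[OF c(2) det inv] by simp
  qed (simp add: normal_SL_one)
  \<comment> \<open>With r = e/c, the identity ((r+1)/2)^2 - ((r-1)/2)^2 = r writes r as a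
    difference of squares. Here 2 has to be invertible.\<close>
  let ?x = "(e / c + 1) / 2" and ?y = "(e / c - 1) / 2"
  have "transvection (- ((c * ?y\<^sup>2) *s axis a 1)) (axis b 1) \<in> N"
    using ab by (intro normal_SL_inverse[OF sq[of ?y] transvection_inverse]) (simp add: axis_nth_if)
  then have "transvection ((c * ?x\<^sup>2) *s axis a 1) (axis b 1)
      ** transvection (- ((c * ?y\<^sup>2) *s axis a 1)) (axis b 1) \<in> N"
    by (intro normal_SL_mult sq)
  also have "transvection ((c * ?x\<^sup>2) *s axis a 1) (axis b 1)
      ** transvection (- ((c * ?y\<^sup>2) *s axis a 1)) (axis b 1)
      = transvection ((c * (?x\<^sup>2 - ?y\<^sup>2)) *s axis a 1) (axis b 1)"
    using ab by (subst transvection_mult) (simp_all add: axis_nth_if vec_eq_iff algebra_simps)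
  also have "?x\<^sup>2 - ?y\<^sup>2 = e / c"
  proof -
    have "?x\<^sup>2 - ?y\<^sup>2 = (?x + ?y) * (?x - ?y)"
      by (simp add: power2_eq_square algebra_simps)
    moreover have "?x + ?y = e / c" "?x - ?y = 1"
      using two by (simp_all add: add_divide_distrib[symmetric] diff_divide_distrib[symmetric])
    ultimately show ?thesis by simp
  qed
  finally show ?thesis
    using c(1) by simp
qed

text \<open>Conjugation by a signed transposition permutes the indices up to signs. As N contains
  the elementary matrices of every parameter, the signs are absorbed into the parameter one starts
  from.\<close>

lemma normal_SL_root_group_transpose:
  assumes "\<And>c. transvection (c *s axis a 1) (axis b 1) \<in> N"
  shows "transvection (c *s axis (Transposition.transpose m n a) 1)
    (axis (Transposition.transpose m n b) 1) \<in> N"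
proof (cases "m = n")
  case False
  let ?s = "\<lambda>k. if k = n then -1 else 1 :: 'a"
  obtain P Q :: "'a^'n^'n" where PQ: "det P = 1" "P ** Q = mat 1"
    "\<And>k. P *v axis k 1 = ?s k *s axis (Transposition.transpose m n k) 1"
    "\<And>k. axis k 1 v* Q = ?s k *s axis (Transposition.transpose m n k) 1"
    using signed_transposition[OF False] by blast
  have "P ** transvection ((c * ?s a * ?s b) *s axis a 1) (axis b 1) ** Q
      = transvection (c *s axis (Transposition.transpose m n a) 1)
          (axis (Transposition.transpose m n b) 1)"
    unfolding transvection_conj[OF PQ(2)] PQ(4) transvection_scaleL[symmetric]
    by (simp add: vec.scale PQ(3))
  then show ?thesis
    using normal_SL_conj[OF assms PQ(1,2)] by metis
qed (use assms in simp)

text \<open>Two transpositions suffice: the first carries a to k, the second carries the image of b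
  to l and leaves k alone.\<close>

lemma normal_SL_all_root_groups:
  assumes ab: "a \<noteq> b" and N1: "\<And>c. transvection (c *s axis a 1) (axis b 1) \<in> N" and kl: "k \<noteq> l"
  shows "transvection (c *s axis k 1) (axis l 1) \<in> N"
proof -
  define b' where "b' = Transposition.transpose a k b"
  have k: "Transposition.transpose a k a = k"
    by simp
  have b': "b' \<noteq> k"
    using ab by (auto simp: b'_def Transposition.transpose_def)
  have "transvection (c *s axis k 1) (axis b' 1) \<in> N" for c
    using normal_SL_root_group_transpose[OF N1, of c a k] unfolding b'_def k .
  then have "transvection (c *s axis (Transposition.transpose b' l k) 1)
      (axis (Transposition.transpose b' l b') 1) \<in> N"
    by (rule normal_SL_root_group_transpose)
  then show ?thesis
    using b' kl by (simp add: Transposition.transpose_def)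
qed

text \<open>Both transvections are conjugate to elementary matrices, and N is invariant under
  conjugation, so the root groups connect them.\<close>

lemma normal_SL_all_transvections:
  assumes two: "(2::'a) \<noteq> 0" and uz: "u \<noteq> 0" "z \<noteq> 0" "dot z u = 0" "transvection u z \<in> N"
    and vw: "dot w v = 0"
  shows "transvection v w \<in> N"
proof (cases "v = 0 \<or> w = 0")
  case False
  obtain P Q a b c where 1: "det P = 1" "P ** Q = mat 1" "a \<noteq> b" "c \<noteq> 0"
    "P ** transvection u z ** Q = transvection (c *s axis a 1) (axis b 1)"
    using transvection_conj_elementary[OF uz(1-3)] .
  obtain P' Q' k l e where 2: "det P' = 1" "P' ** Q' = mat 1" "k \<noteq> l" "e \<noteq> 0"
    "P' ** transvection v w ** Q' = transvection (e *s axis k 1) (axis l 1)"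
    using transvection_conj_elementary[of v w] False vw by blast
  have "transvection (c *s axis a 1) (axis b 1) \<in> N"
    using normal_SL_conj[OF uz(4) 1(1,2)] 1(5) by simp
  then have "transvection (e *s axis k 1) (axis l 1) \<in> N"
    by (rule normal_SL_all_root_groups[OF 1(3) normal_SL_root_group[OF 1(3,4) _ two] 2(3)])
  then show ?thesis
    using normal_SL_conj_iff[OF 2(1,2), of "transvection v w"] 2(5) by simp
qed (use normal_SL_one in auto)

end

section \<open>Column reduction by transvections\<close>

lemma matrix_nth_basis: "(A :: 'a::semiring_1^'n^'m) $ i $ j = (A *v axis j 1) $ i"
  by (simp add: matrix_vector_mult_def axis_nth_if if_distrib[of "\<lambda>x. _ * x"] cong: if_cong)

lemma det_columns_except_one:
  fixes B :: "'a::field^'n^'n"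
  assumes "\<And>j. j \<noteq> m \<Longrightarrow> B *v axis j 1 = axis j 1"
  shows "det B = (B *v axis m 1) $ m"
proof -
  have col: "B $ i $ j = (if i = j then 1 else 0)" if "j \<noteq> m" for i j
    using assms[OF that] by (subst matrix_nth_basis) (simp add: axis_nth_if)
  have "B = (\<chi> i j. if j = m then (mat 1 *v (B *v axis m 1)) $ i else mat 1 $ i $ j)"
    using col unfolding matrix_vector_mul_lid
    by (auto simp: vec_eq_iff mat_def matrix_nth_basis[of B _ m])
  then have "det B = det (\<chi> i j. if j = m then (mat 1 *v (B *v axis m 1)) $ i else (mat 1 :: 'a^'n^'n) $ i $ j)"
    by simp
  also have "\<dots> = (B *v axis m 1) $ m * det (mat 1 :: 'a^'n^'n)"
    by (rule cramer_lemma)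
  finally show ?thesis
    by (simp add: det_I)
qed

text \<open>If column m were supported on S, subtracting from e_m the matching combination of the
  fixed e_i would give a nonzero vector in the kernel of B.\<close>

lemma column_entry_nonzero:
  fixes B :: "'a::field^'n^'n"
  assumes det: "det B = 1" and S: "\<And>j. j \<in> S \<Longrightarrow> B *v axis j 1 = axis j 1" and m: "m \<notin> S"
  shows "\<exists>i. i \<notin> S \<and> (B *v axis m 1) $ i \<noteq> 0"
proof (rule ccontr)
  assume "\<not> ?thesis"
  then have zero: "\<And>i. i \<notin> S \<Longrightarrow> (B *v axis m 1) $ i = 0" by blast
  define x where "x = B *v axis m 1"
  define y where "y = axis m 1 - (\<Sum>i\<in>S. x $ i *s axis i 1)"
  have "B *v y = x - (\<Sum>i\<in>S. x $ i *s axis i 1)"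
    by (simp add: y_def x_def matrix_vector_mult_diff_distrib vec.sum vec.scale S)
  also have "(\<Sum>i\<in>S. x $ i *s axis i 1) = x"
    using zero by (auto simp: vec_eq_iff x_def[symmetric] sum_component axis_nth_if
        if_distrib[of "\<lambda>x. _ * x"] cong: if_cong)
  finally have "B *v y = 0" by simp
  moreover obtain C where "C ** B = mat 1"
    using det invertible_det_nz[of B] unfolding invertible_def by auto
  ultimately have "y = 0"
    by (metis matrix_vector_mul_assoc matrix_vector_mul_lid matrix_vector_mult_0_right)
  moreover have "y $ m = 1"
    using m by (simp add: y_def sum_component axis_nth_if if_distrib[of "\<lambda>x. _ * x"] cong: if_cong)
  ultimately show False by simp
qed

text \<open>If \<open>w\<cdot>x = w\<cdot>y = 1\<close>, then the transvection \<open>1 + (y - x)w\<^sup>T\<close> maps \<open>x\<close> to \<open>y\<close> and fixes every \<open>v\<close> with \<open>w\<cdot>v = 0\<close>.\<close>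
lemma clear_column:
  fixes B :: "'a::field^'n^'n"
  assumes T: "\<And>v w. dot w v = 0 \<Longrightarrow> transvection v w \<in> N"
    and mult: "\<And>A B. A \<in> N \<Longrightarrow> B \<in> N \<Longrightarrow> A ** B \<in> N"
    and det: "det B = 1" and S: "\<And>j. j \<in> S \<Longrightarrow> B *v axis j 1 = axis j 1" and m: "m \<notin> S"
  shows "\<exists>G\<in>N. \<forall>j\<in>insert m S. G *v (B *v axis j 1) = axis j 1"
proof -
  have move: "\<exists>G\<in>N. G *v x = axis m 1 \<and> (\<forall>j\<in>S. G *v axis j 1 = axis j 1)"
    if "dot w x = 1" "w $ m = 1" "\<forall>j\<in>S. w $ j = 0" for w x :: "'a^'n"
    using that by (intro bexI[OF _ T[of w "axis m 1 - x"]]) (auto simp: transvection_mult_vector)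
  have pivot: "\<exists>G\<in>N. G *v x = axis m 1 \<and> (\<forall>j\<in>S. G *v axis j 1 = axis j 1)"
    if "i \<notin> S" "i \<noteq> m" "x $ i \<noteq> 0" for i and x :: "'a^'n"
    \<comment> \<open>The coefficient at i solves w.x = 1 while keeping w_m = 1; w vanishes on S
      because neither i nor m is in S.\<close>
    by (rule move[of "axis m 1 + ((1 - x $ m) / x $ i) *s axis i 1"])
      (use that m in \<open>auto simp: axis_nth_if\<close>)
  define x where "x = B *v axis m 1"
  have "\<exists>G\<in>N. G *v x = axis m 1 \<and> (\<forall>j\<in>S. G *v axis j 1 = axis j 1)"
  proof (cases "x $ m = 1 \<or> (\<exists>i. i \<notin> S \<and> i \<noteq> m \<and> x $ i \<noteq> 0)")
    case True
    then show ?thesis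
    proof
      assume "x $ m = 1"
      then show ?thesis
        by (intro move[of "axis m 1"]) (use m in \<open>auto simp: axis_nth_if\<close>)
    qed (use pivot in blast)
  next
    case False
    then have xm: "x $ m \<noteq> 0"
      using column_entry_nonzero[OF det S m] unfolding x_def by blast
    \<comment> \<open>Here x_m is the only nonzero entry outside S and differs from 1. If no index
      were left over, det B would equal x_m. Adding row m to a free row l then creates the missing
      pivot.\<close>
    have "\<exists>l. l \<notin> insert m S"
    proof (rule ccontr)
      assume "\<not> ?thesis"
      then have "j \<in> S" if "j \<noteq> m" for j
        using that by blast
      then show False
        using det_columns_except_one[of m B] S det False unfolding x_def by simp
    qed
    then obtain l where l: "l \<notin> S" "l \<noteq> m" by blast
    then have "x $ l = 0"
      using False by blast
    have T1: "transvection (axis l 1) (axis m 1) \<in> N"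
      using l by (intro T) (simp add: axis_nth_if)
    have "(transvection (axis l 1) (axis m 1) *v x) $ l \<noteq> 0"
      using xm \<open>x $ l = 0\<close> l by (simp add: transvection_mult_vector axis_nth_if)
    then obtain G where G: "G \<in> N" "G *v (transvection (axis l 1) (axis m 1) *v x) = axis m 1"
        "\<forall>j\<in>S. G *v axis j 1 = axis j 1"
      using pivot[OF l] by blast
    have "\<forall>j\<in>S. transvection (axis l 1) (axis m 1) *v axis j 1 = (axis j 1 :: 'a^'n)"
      using m by (auto simp: transvection_mult_vector axis_nth_if)
    with G mult[OF G(1) T1] show ?thesis
      by (intro bexI[of _ "G ** transvection (axis l 1) (axis m 1)"])
        (simp_all add: matrix_vector_mul_assoc[symmetric])
  qed
  then show ?thesis
    using S by (auto simp: x_def)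
qed

text \<open>Gaussian elimination inside N: the set of columns of G A already equal to basis vectors
  grows one index at a time, until G A = 1 and A is the inverse of an element of N.\<close>

lemma normal_SL_eq_carrier:
  fixes N :: "('a::field^'n^'n) set"
  assumes N: "N \<lhd> SL" and two: "(2::'a) \<noteq> 0"
    and uz: "u \<noteq> 0" "z \<noteq> 0" "dot z u = 0" "transvection u z \<in> N"
  shows "N = carrier SL"
proof
  note T = normal_SL_all_transvections[OF N two uz]
  note mult = normal_SL_mult[OF N]
  show "carrier SL \<subseteq> N"
  proof
    fix A :: "'a^'n^'n" assume "A \<in> carrier SL"
    then have A: "det A = 1" by (simp add: carrier_SL)
    have "\<exists>G\<in>N. \<forall>j\<in>S. (G ** A) *v axis j 1 = axis j 1" for S :: "'n set"
    proof (induction S rule: finite_induct[OF finite])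
      case 1
      then show ?case using normal_SL_one[OF N] by blast
    next
      case (2 m S)
      then obtain G where G: "G \<in> N" "\<And>j. j \<in> S \<Longrightarrow> (G ** A) *v axis j 1 = axis j 1" by blast
      have "det (G ** A) = 1"
        using A G(1) normal_SL_det[OF N] by (simp add: det_mul)
      then obtain H where "H \<in> N" "\<forall>j\<in>insert m S. H *v ((G ** A) *v axis j 1) = axis j 1"
        using clear_column[OF T mult _ G(2) 2(2)] by blast
      then show ?case
        using mult[of H G] G(1)
        by (intro bexI[of _ "H ** G"]) (auto simp: matrix_vector_mul_assoc matrix_mul_assoc)
    qed
    then obtain G where G: "G \<in> N" "\<And>j. (G ** A) *v axis j 1 = axis j 1" by blast
    then have "G ** A = mat 1"
      by (auto simp: vec_eq_iff mat_def axis_nth_if matrix_nth_basis[of "G ** A"])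
    then show "A \<in> N"
      by (rule normal_SL_inverse[OF N G(1)])
  qed
qed (use normal_imp_subgroup[OF N] subgroup.subset in blast)

section \<open>Topology of the special linear group\<close>

lemma continuous_on_det [continuous_intros]:
  fixes f :: "_ \<Rightarrow> 'a::topological_field^'n^'n"
  assumes "continuous_on S f"
  shows "continuous_on S (\<lambda>x. det (f x))"
  unfolding det_def by (intro continuous_intros assms)

lemma continuous_on_matrix_mult [continuous_intros]:
  fixes f :: "_ \<Rightarrow> 'a::topological_field^'n^'m" and g :: "_ \<Rightarrow> 'a^'k^'n"
  assumes "continuous_on S f" "continuous_on S g"
  shows "continuous_on S (\<lambda>x. f x ** g x)"
  unfolding matrix_matrix_mult_def by (intro continuous_intros assms)

text \<open>Tychonoff's theorem for functions, carried over along the continuous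
  \<open>vec_lambda\<close>.\<close>

lemma compact_vec:
  fixes K :: "'n::finite \<Rightarrow> 'a::topological_space set"
  assumes "\<And>i. compact (K i)"
  shows "compact {x::'a^'n. \<forall>i. x $ i \<in> K i}"
proof -
  have "compactin (product_topology (\<lambda>i. euclidean) UNIV) (PiE UNIV K)"
    using assms by (simp add: compactin_PiE)
  then have "compact (PiE UNIV K)"
    by (simp add: euclidean_product_topology)
  then have "compact (vec_lambda ` PiE UNIV K)"
    by (intro compact_continuous_image continuous_on_vec_lambda)
      (rule continuous_on_subset[OF continuous_on_product_coordinates], simp)
  also have "vec_lambda ` PiE UNIV K = {x. \<forall>i. x $ i \<in> K i}"
  proof (intro subset_antisym subsetI)
    fix x :: "'a^'n" assume "x \<in> {x. \<forall>i. x $ i \<in> K i}"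
    then have "x = vec_lambda (vec_nth x)" "vec_nth x \<in> PiE UNIV K"
      by auto
    then show "x \<in> vec_lambda ` PiE UNIV K"
      by (rule image_eqI)
  qed auto
  finally show ?thesis .
qed

lemma compact_matrices:
  fixes K :: "'a::topological_space set"
  assumes "compact K"
  shows "compact {M::'a^'n^'m. \<forall>i j. M $ i $ j \<in> K}"
  using compact_vec[of "\<lambda>_. {x::'a^'n. \<forall>j. x $ j \<in> K}", OF compact_vec[OF assms]] by simp

text \<open>Cramer's rule with determinant 1: the entries of the inverse are polynomials in those of
  A, which gives continuity of inversion.\<close>

lemma SL_inverse_nth:
  fixes A :: "'a::field^'n^'n"
  assumes "det A = 1"
  shows "inv\<^bsub>SL\<^esub> A = (\<chi> k l. det (\<chi> i j. if j = k then axis l 1 $ i else A $ i $ j))"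
proof -
  have "A *v (inv\<^bsub>SL\<^esub> A *v axis l 1) = axis l 1" for l
    by (simp add: matrix_vector_mul_assoc SL_right_inverse assms)
  then have "inv\<^bsub>SL\<^esub> A *v axis l 1 = (\<chi> k. det (\<chi> i j. if j = k then axis l 1 $ i else A $ i $ j) / det A)" for l
    using cramer[of A "inv\<^bsub>SL\<^esub> A *v axis l 1" "axis l 1"] assms by simp
  moreover have "(inv\<^bsub>SL\<^esub> A) $ k $ l = (inv\<^bsub>SL\<^esub> A *v axis l 1) $ k" for k l
    by (rule matrix_nth_basis)
  ultimately show ?thesis
    using assms by (simp add: vec_eq_iff)
qed

lemma Hausdorff_space_matrices:
  "Hausdorff_space (euclidean :: ('a::t2_space^'n^'m) topology)"
  unfolding Hausdorff_space_def
proof (intro allI impI, elim conjE)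
  fix M M' :: "'a^'n^'m" assume "M \<noteq> M'"
  then obtain i j where ij: "M $ i $ j \<noteq> M' $ i $ j"
    by (auto simp: vec_eq_iff)
  then obtain U V where UV: "open U" "open V" "M $ i $ j \<in> U" "M' $ i $ j \<in> V" "U \<inter> V = {}"
    using hausdorff[OF ij] by metis
  have "open ((\<lambda>M::'a^'n^'m. M $ i $ j) -` U)" "open ((\<lambda>M::'a^'n^'m. M $ i $ j) -` V)"
    using open_vimage_vec_nth[OF open_vimage_vec_nth[OF UV(1)], of i j]
      open_vimage_vec_nth[OF open_vimage_vec_nth[OF UV(2)], of i j]
    by (simp_all add: vimage_def)
  moreover have "disjnt ((\<lambda>M::'a^'n^'m. M $ i $ j) -` U) ((\<lambda>M. M $ i $ j) -` V)"
    using UV by (auto simp: disjnt_def)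
  ultimately show "\<exists>U V. openin euclidean U \<and> openin euclidean V \<and> M \<in> U \<and> M' \<in> V \<and> disjnt U V"
    using UV(3,4)
    by (intro exI[of _ "(\<lambda>M. M $ i $ j) -` U"] exI[of _ "(\<lambda>M. M $ i $ j) -` V"]) simp
qed

lemma topspace_SL_topology [simp]: "topspace SL_topology = carrier SL"
  by (simp add: SL_topology_def)

lemma hausdorff_topological_group_SL:
  "hausdorff_topological_group (SL :: ('a::topological_field^'n^'n) monoid) SL_topology"
  unfolding hausdorff_topological_group_def
proof (intro conjI)
  let ?S = "carrier SL :: ('a^'n^'n) set"
  show "Hausdorff_space (SL_topology :: ('a^'n^'n) topology)"
    unfolding SL_topology_def by (intro Hausdorff_space_subtopology Hausdorff_space_matrices)
  have "continuous_on (?S \<times> ?S) (\<lambda>p. fst p ** snd p)"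
    by (intro continuous_intros)
  then show "continuous_map (prod_topology SL_topology SL_topology) (SL_topology :: ('a^'n^'n) topology)
      (\<lambda>(x, y). x \<otimes>\<^bsub>SL\<^esub> y)"
    unfolding SL_topology_def prod_topology_subtopology_eu continuous_map_in_subtopology
      continuous_map_iff_continuous
    by (auto simp: mult_SL case_prod_unfold carrier_SL det_mul)
  have "continuous_on ?S (\<lambda>A. \<chi> k l. det (\<chi> i j. if j = k then axis l 1 $ i else A $ i $ j))"
  proof (intro continuous_intros)
    fix i j k l
    show "continuous_on ?S (\<lambda>A. if j = k then axis l 1 $ i else A $ i $ j)"
      by (cases "j = k") (auto intro!: continuous_intros)
  qed
  then have "continuous_on ?S (\<lambda>A. inv\<^bsub>SL\<^esub> A)"
    by (rule continuous_on_eq) (simp add: SL_inverse_nth carrier_SL)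
  then show "continuous_map SL_topology (SL_topology :: ('a^'n^'n) topology) (\<lambda>A. inv\<^bsub>SL\<^esub> A)"
    unfolding SL_topology_def continuous_map_in_subtopology continuous_map_iff_continuous
    using group.inv_closed[OF group_SL] by auto
qed (simp_all add: group_SL)

text \<open>Every entry \<open>x\<close> of \<open>A\<close> satisfies \<open>x\<^sup>n = det (x A\<^sup>-\<^sup>1)\<close>, and the entries of \<open>x A\<^sup>-\<^sup>1\<close> are bounded:
  they are entries of \<open>A E\<^sub>a\<^sub>b A\<^sup>-\<^sup>1\<close>, and for \<open>a = b\<close> one writes \<open>E\<^sub>a\<^sub>a = E\<^sub>a\<^sub>c E\<^sub>c\<^sub>a\<close>.\<close>
lemma SL_bounded_adjoint:
  fixes R :: "'a::local_field set"
  assumes R: "compact R"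
  obtains C :: "('a^'n^'n) set" where "compact C"
    "\<And>A B. det A = 1 \<Longrightarrow> A ** B = mat 1 \<Longrightarrow>
      (\<And>a b j k. a \<noteq> b \<Longrightarrow> A $ j $ a * B $ b $ k \<in> R) \<Longrightarrow> A \<in> C"
proof -
  \<comment> \<open>P bounds the diagonal case: A_ja B_ak is the sum over m of (A_ja B_cm)(A_mc
    B_ak), because (B A)_cc = 1.\<close>
  define P where "P = (\<lambda>(x, y). \<Sum>m\<in>UNIV. x $ m * y $ m) ` ({x::'a^'n. \<forall>i. x $ i \<in> R} \<times> {x. \<forall>i. x $ i \<in> R})"
  \<comment> \<open>The element 1 covers dimension one, where there is no second index c and the
    only product is (A B)_aa = 1.\<close>
  define R1 where "R1 = insert 1 (R \<union> P)"
  have "compact P"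
    unfolding P_def case_prod_unfold
    by (intro compact_continuous_image compact_Times compact_vec R continuous_intros)
  then have R1: "compact R1"
    unfolding R1_def using R by (simp add: compact_insert compact_Un)
  have "compact (det ` {M::'a^'n^'n. \<forall>i j. M $ i $ j \<in> R1})" (is "compact ?E")
    by (intro compact_continuous_image compact_matrices R1 continuous_intros continuous_on_id)
  moreover have "CARD('n) \<ge> 1"
    by (simp add: Suc_le_eq)
  ultimately obtain D where D: "compact D" "\<And>x. x ^ CARD('n) \<in> ?E \<Longrightarrow> x \<in> D"
    by (rule compact_power_preimage) blast
  have entry: "A $ j $ a \<in> D"
    if A: "det A = 1" and AB: "A ** B = mat 1"
      and bd: "\<And>a b j k. a \<noteq> b \<Longrightarrow> A $ j $ a * B $ b $ k \<in> R" for A B :: "'a^'n^'n" and j a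
  proof (rule D(2))
    have BA: "B ** A = mat 1"
      using AB matrix_left_right_inverse by blast
    have "A $ j $ a * B $ b $ k \<in> R1" for b k
    proof (cases "a = b")
      case [simp]: True
      show ?thesis
      proof (cases "\<exists>c. c \<noteq> a")
        case True
        then obtain c where c: "c \<noteq> a" by blast
        let ?x = "(\<chi> m. A $ j $ a * B $ c $ m) :: 'a^'n" and ?y = "(\<chi> m. A $ m $ c * B $ a $ k) :: 'a^'n"
        have "(\<Sum>m\<in>UNIV. ?x $ m * ?y $ m) = A $ j $ a * (\<Sum>m\<in>UNIV. B $ c $ m * A $ m $ c) * B $ a $ k"
          by (simp add: sum_distrib_left sum_distrib_right mult_ac)
        also have "(\<Sum>m\<in>UNIV. B $ c $ m * A $ m $ c) = (B ** A) $ c $ c"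
          by (simp add: matrix_matrix_mult_def)
        finally have "A $ j $ a * B $ a $ k = (\<Sum>m\<in>UNIV. ?x $ m * ?y $ m)"
          by (simp add: BA mat_def)
        also have "\<dots> \<in> P"
          unfolding P_def using bd c by (intro image_eqI[of _ _ "(?x, ?y)"]) auto
        finally show ?thesis
          by (simp add: R1_def)
      next
        case False
        then have UNIV: "UNIV = {a}" by blast
        then have [simp]: "j = a" "k = a" by blast+
        have "A $ a $ a * B $ a $ a = (A ** B) $ a $ a"
          by (simp add: matrix_matrix_mult_def UNIV)
        then show ?thesis
          by (simp add: AB mat_def R1_def)
      qed
    qed (simp add: R1_def bd)
    moreover have "A $ j $ a ^ CARD('n) = det (\<chi> b. A $ j $ a *s B $ b)"
      by (simp add: det_rows_mul det_right_inverse_1[OF A AB])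
    ultimately show "A $ j $ a ^ CARD('n) \<in> det ` {M::'a^'n^'n. \<forall>i j. M $ i $ j \<in> R1}"
      by (intro image_eqI) auto
  qed
  show ?thesis
  proof (rule that[OF compact_matrices[OF D(1)]])
    fix A B :: "'a^'n^'n"
    assume "det A = 1" "A ** B = mat 1" "\<And>a b j k. a \<noteq> b \<Longrightarrow> A $ j $ a * B $ b $ k \<in> R"
    then show "A \<in> {M. \<forall>i j. M $ i $ j \<in> D}"
      using entry[of A B] by blast
  qed
qed

section \<open>Topological groups and their quotients\<close>

lemma openin_prod_topologyE:
  assumes "openin (prod_topology X Y) S" "(x, y) \<in> S"
  obtains U V where "openin X U" "openin Y V" "x \<in> U" "y \<in> V" "U \<times> V \<subseteq> S"
  using assms unfolding openin_prod_topology_alt by meson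

context
  fixes G :: "('a, 'b) monoid_scheme" (structure) and T :: "'a topology"
  assumes G: "hausdorff_topological_group G T"
begin

lemma htg_group: "group G"
  and htg_topspace: "topspace T = carrier G"
  and htg_Hausdorff: "Hausdorff_space T"
  using G by (simp_all add: hausdorff_topological_group_def)

lemma htg_continuous_mult:
  assumes "continuous_map X T f" "continuous_map X T g"
  shows "continuous_map X T (\<lambda>x. f x \<otimes> g x)"
proof -
  have "continuous_map (prod_topology T T) T (\<lambda>(x, y). x \<otimes> y)"
    using G by (simp add: hausdorff_topological_group_def)
  from continuous_map_compose[OF continuous_map_pairedI[OF assms] this] show ?thesis
    by (simp add: o_def)
qed

lemma htg_continuous_inv:
  assumes "continuous_map X T f"
  shows "continuous_map X T (\<lambda>x. inv f x)"
proof -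
  have "continuous_map T T (\<lambda>x. inv x)"
    using G by (simp add: hausdorff_topological_group_def)
  from continuous_map_compose[OF assms this] show ?thesis
    by (simp add: o_def)
qed

text \<open>Continuity of conjugation at (1, 1). In the application x is the image of a possibly
  huge matrix and y the image of a small elementary one.\<close>

lemma htg_conj_nhds:
  assumes "openin T W" "\<one> \<in> W"
  obtains U V where "openin T U" "openin T V" "\<one> \<in> U" "\<one> \<in> V"
    "\<And>x y. x \<in> U \<Longrightarrow> y \<in> V \<Longrightarrow> x \<otimes> y \<otimes> inv x \<in> W"
proof -
  interpret group G by (rule htg_group)
  let ?S = "{p \<in> topspace (prod_topology T T). fst p \<otimes> snd p \<otimes> inv (fst p) \<in> W}"
  have "openin (prod_topology T T) ?S"
    by (rule openin_continuous_map_preimage[OF _ assms(1)])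
      (intro htg_continuous_mult htg_continuous_inv continuous_map_fst continuous_map_snd)
  moreover have "(\<one>, \<one>) \<in> ?S"
    using assms by (simp add: htg_topspace)
  ultimately obtain U V where "openin T U" "openin T V" "\<one> \<in> U" "\<one> \<in> V" and sub: "U \<times> V \<subseteq> ?S"
    by (rule openin_prod_topologyE)
  moreover have "x \<otimes> y \<otimes> inv x \<in> W" if "x \<in> U" "y \<in> V" for x y
    using subsetD[OF sub, of "(x, y)"] that by simp
  ultimately show ?thesis
    using that[of U V] by blast
qed

text \<open>A homomorphism which is proper near the identity is a quotient map: near \<open>\<phi> g\<close> the complement
  of an open saturated set has compact, hence closed, image.\<close>
lemma htg_quotient_map_if_locally_proper:
  assumes H: "hausdorff_topological_group H TH"
    and \<phi>: "\<phi> \<in> hom G H" "continuous_map T TH \<phi>" "\<phi> ` carrier G = carrier H"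
    and W: "openin TH W" "\<one>\<^bsub>H\<^esub> \<in> W" and C: "compactin T C" "\<And>g. g \<in> carrier G \<Longrightarrow> \<phi> g \<in> W \<Longrightarrow> g \<in> C"
  shows "quotient_map T TH \<phi>"
  unfolding quotient_map_def
proof (intro conjI allI impI)
  have group_H: "group H"
    using H by (simp add: hausdorff_topological_group_def)
  have top_H: "topspace TH = carrier H"
    using H by (simp add: hausdorff_topological_group_def)
  interpret hom: group_hom G H \<phi>
    by (intro group_hom.intro group_hom_axioms.intro htg_group group_H \<phi>)
  show "\<phi> ` topspace T = topspace TH"
    using \<phi>(3) by (simp add: htg_topspace top_H)
  fix U assume U: "U \<subseteq> topspace TH"
  show "openin T {x \<in> topspace T. \<phi> x \<in> U} = openin TH U"
  proof
    assume op: "openin T {x \<in> topspace T. \<phi> x \<in> U}"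
    show "openin TH U"
    proof (subst openin_subopen, intro ballI)
      fix y assume y: "y \<in> U"
      then obtain g where g: "g \<in> carrier G" "y = \<phi> g"
        using U \<phi>(3) top_H by blast
      define K where "K = (\<lambda>x. x \<otimes> g) ` C - {x \<in> topspace T. \<phi> x \<in> U}"
      have "continuous_map T T (\<lambda>x. x \<otimes> g)"
        using g by (intro htg_continuous_mult) (auto simp: htg_topspace)
      then have "compactin T ((\<lambda>x. x \<otimes> g) ` C)"
        by (rule image_compactin[OF C(1)])
      then have "compactin T ((topspace T - {x \<in> topspace T. \<phi> x \<in> U}) \<inter> (\<lambda>x. x \<otimes> g) ` C)"
        using op by (intro closed_Int_compactin closedin_diff) simp_all
      moreover have "(\<lambda>x. x \<otimes> g) ` C \<subseteq> topspace T"
        using compactin_subset_topspace[OF C(1)] g by (auto simp: htg_topspace)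
      then have "(topspace T - {x \<in> topspace T. \<phi> x \<in> U}) \<inter> (\<lambda>x. x \<otimes> g) ` C = K"
        unfolding K_def by blast
      ultimately have "compactin T K"
        by simp
      then have cl: "closedin TH (\<phi> ` K)"
        using image_compactin[OF _ \<phi>(2)] compactin_imp_closedin H
        by (auto simp: hausdorff_topological_group_def)
      define O' where "O' = {z \<in> topspace TH. z \<otimes>\<^bsub>H\<^esub> inv\<^bsub>H\<^esub> y \<in> W} - \<phi> ` K"
      show "\<exists>V. openin TH V \<and> y \<in> V \<and> V \<subseteq> U"
      proof (intro exI conjI)
        have yH: "y \<in> carrier H"
          using g by simp
        have "continuous_map TH TH (\<lambda>z. z \<otimes>\<^bsub>H\<^esub> inv\<^bsub>H\<^esub> y)"
        proof -
          have "continuous_map (prod_topology TH TH) TH (\<lambda>(x, y). x \<otimes>\<^bsub>H\<^esub> y)"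
            using H by (simp add: hausdorff_topological_group_def)
          moreover have "continuous_map TH (prod_topology TH TH) (\<lambda>z. (z, inv\<^bsub>H\<^esub> y))"
            using yH by (intro continuous_map_pairedI) (auto simp: top_H)
          ultimately show ?thesis
            by (auto dest: continuous_map_compose[rotated] simp: o_def)
        qed
        then show "openin TH O'"
          unfolding O'_def
          by (intro openin_diff openin_continuous_map_preimage[OF _ W(1)] cl)
        show "y \<in> O'"
          using y yH g U W(2) compactin_subset_topspace[OF C(1)] by (auto simp: O'_def K_def top_H htg_topspace)
        show "O' \<subseteq> U"
        proof
          fix z assume z: "z \<in> O'"
          then obtain x where x: "x \<in> carrier G" "z = \<phi> x"
            using \<phi>(3) by (auto simp: O'_def top_H)
          have "\<phi> (x \<otimes> inv g) \<in> W"
            using z x g by (simp add: O'_def)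
          then have "x \<otimes> inv g \<in> C"
            using x g C(2) by simp
          moreover have "x = (x \<otimes> inv g) \<otimes> g"
            using x g by (simp add: hom.G.m_assoc)
          ultimately have "x \<in> (\<lambda>x. x \<otimes> g) ` C"
            by (metis imageI)
          then show "z \<in> U"
            using z x by (auto simp: O'_def K_def)
        qed
      qed
    qed
  qed (rule openin_continuous_map_preimage[OF \<phi>(2)])
qed

section \<open>Quotients by closed normal subgroups\<close>

context
  fixes N :: "'a set"
  assumes N: "N \<lhd> G" "closedin T N"
begin

lemma quotient_group_eq_iff:
  assumes "x \<in> carrier G" "y \<in> carrier G"
  shows "N #> x = N #> y \<longleftrightarrow> x \<otimes> inv y \<in> N"
proof -
  interpret normal N G by (rule N)
  show ?thesis
    using assms rcos_module[OF htg_group, of y x] repr_independence[of x N y]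
      repr_independenceD[of N x y] subgroup_axioms by metis
qed

text \<open>The saturation of an open U is the union of its translates by elements of N, each of
  them open.\<close>

lemma open_map_quotient_group:
  "open_map T (quotient_group_topology G T N) (\<lambda>x. N #> x)"
  unfolding open_map_def
proof (intro allI impI)
  interpret normal N G by (rule N)
  fix U assume U: "openin T U"
  then have sub: "U \<subseteq> carrier G"
    using openin_subset htg_topspace by metis
  have "{x \<in> carrier G. N #> x \<in> (\<lambda>x. N #> x) ` U} = (\<Union>n\<in>N. {x \<in> carrier G. n \<otimes> x \<in> U})"
  proof (intro subset_antisym subsetI)
    fix x assume "x \<in> {x \<in> carrier G. N #> x \<in> (\<lambda>x. N #> x) ` U}"
    then obtain u where u: "x \<in> carrier G" "u \<in> U" "N #> u = N #> x"
      by auto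
    then have "u \<otimes> inv x \<in> N"
      using quotient_group_eq_iff[of u x] sub by blast
    moreover have "(u \<otimes> inv x) \<otimes> x = u"
      using u sub by (simp add: m_assoc subset_iff)
    ultimately show "x \<in> (\<Union>n\<in>N. {x \<in> carrier G. n \<otimes> x \<in> U})"
      using u by (intro UN_I[of "u \<otimes> inv x"]) auto
  next
    fix x assume "x \<in> (\<Union>n\<in>N. {x \<in> carrier G. n \<otimes> x \<in> U})"
    then obtain n where n: "n \<in> N" "x \<in> carrier G" "n \<otimes> x \<in> U" by auto
    then have "N #> (n \<otimes> x) = N #> x"
      by (subst quotient_group_eq_iff) (auto simp: m_assoc)
    then show "x \<in> {x \<in> carrier G. N #> x \<in> (\<lambda>x. N #> x) ` U}"
      using n by (metis (mono_tags, lifting) CollectI imageI)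
  qed
  moreover have "openin T {x \<in> carrier G. n \<otimes> x \<in> U}" if "n \<in> N" for n
  proof -
    have "continuous_map T T (\<lambda>x. n \<otimes> x)"
      using that by (intro htg_continuous_mult) (auto simp: htg_topspace)
    from openin_continuous_map_preimage[OF this U] show ?thesis
      by (simp add: htg_topspace)
  qed
  ultimately show "openin (quotient_group_topology G T N) ((\<lambda>x. N #> x) ` U)"
    using sub unfolding quotient_group_topology_def openin_quotient_topology
    by (auto simp: htg_topspace)
qed

lemma quotient_map_quotient_group:
  "quotient_map T (quotient_group_topology G T N) (\<lambda>x. N #> x)"
  unfolding quotient_group_topology_def by (rule quotient_map_quotient_topology)

lemma topspace_quotient_group:
  "topspace (quotient_group_topology G T N) = carrier (G Mod N)"
  by (simp add: quotient_group_topology_def topspace_quotient_topology htg_topspace carrier_FactGroup)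

lemma hausdorff_topological_group_quotient:
  "hausdorff_topological_group (G Mod N) (quotient_group_topology G T N)"
  unfolding hausdorff_topological_group_def
proof (intro conjI)
  interpret normal N G by (rule N)
  let ?q = "\<lambda>x. N #> x" and ?Q = "quotient_group_topology G T N"
  interpret M: group "G Mod N" by (rule factorgroup_is_group)
  interpret q: group_hom G "G Mod N" ?q
    by (intro group_hom.intro group_hom_axioms.intro htg_group factorgroup_is_group r_coset_hom_Mod)
  note cont = quotient_imp_continuous_map[OF quotient_map_quotient_group]
  show "group (G Mod N)"
    by (rule factorgroup_is_group)
  show "topspace ?Q = carrier (G Mod N)"
    by (rule topspace_quotient_group)
  show "Hausdorff_space ?Q"
    unfolding Hausdorff_space_def
  proof (intro allI impI, elim conjE)
    fix X Y assume "X \<in> topspace ?Q" "Y \<in> topspace ?Q" and ne: "X \<noteq> Y"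
    then obtain x y where xy: "x \<in> carrier G" "y \<in> carrier G" "X = ?q x" "Y = ?q y"
      unfolding topspace_quotient_group carrier_FactGroup by blast
    \<comment> \<open>Distinct cosets mean x y^-1 outside the closed N. A box around (x, y) inside
      this open set projects to disjoint open sets.\<close>
    let ?S = "{p \<in> topspace (prod_topology T T). fst p \<otimes> inv (snd p) \<in> topspace T - N}"
    have "openin (prod_topology T T) ?S"
      using N(2)
      by (intro openin_continuous_map_preimage[of _ T] htg_continuous_mult htg_continuous_inv
          continuous_map_fst continuous_map_snd) (simp add: openin_diff)
    moreover have "(x, y) \<in> ?S"
      using xy ne quotient_group_eq_iff by (simp add: htg_topspace)
    ultimately obtain A B where AB: "openin T A" "openin T B" "x \<in> A" "y \<in> B" "A \<times> B \<subseteq> ?S"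
      by (rule openin_prod_topologyE)
    have "disjnt (?q ` A) (?q ` B)"
    proof -
      have "?q a \<noteq> ?q b" if "a \<in> A" "b \<in> B" for a b
        using that AB(5) quotient_group_eq_iff[of a b] by (auto simp: htg_topspace)
      then show ?thesis by (auto simp: disjnt_def)
    qed
    then show "\<exists>U V. openin ?Q U \<and> openin ?Q V \<and> X \<in> U \<and> Y \<in> V \<and> disjnt U V"
      using AB xy open_map_quotient_group unfolding open_map_def by blast
  qed
  \<comment> \<open>A product of quotient maps need not be a quotient map, so boxes are pushed
    forward by the open projection. For inversion, with its single argument, the quotient property
    is enough.\<close>
  show "continuous_map (prod_topology ?Q ?Q) ?Q (\<lambda>(X, Y). X \<otimes>\<^bsub>G Mod N\<^esub> Y)"
    unfolding continuous_map_def
  proof (intro conjI allI impI)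
    show "(\<lambda>(X, Y). X \<otimes>\<^bsub>G Mod N\<^esub> Y) \<in> topspace (prod_topology ?Q ?Q) \<rightarrow> topspace ?Q"
      using M.m_closed by (auto simp: topspace_quotient_group simp del: mult_FactGroup)
    fix U assume U: "openin ?Q U"
    show "openin (prod_topology ?Q ?Q) {p \<in> topspace (prod_topology ?Q ?Q). (\<lambda>(X, Y). X \<otimes>\<^bsub>G Mod N\<^esub> Y) p \<in> U}"
      unfolding openin_prod_topology_alt
    proof (intro allI impI)
      fix X Y assume XY: "(X, Y) \<in> {p \<in> topspace (prod_topology ?Q ?Q). (\<lambda>(X, Y). X \<otimes>\<^bsub>G Mod N\<^esub> Y) p \<in> U}"
      then obtain x y where xy: "x \<in> carrier G" "y \<in> carrier G" "X = ?q x" "Y = ?q y"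
        unfolding topspace_prod_topology topspace_quotient_group carrier_FactGroup by auto
      let ?S = "{p \<in> topspace (prod_topology T T). ?q (fst p \<otimes> snd p) \<in> U}"
      have "continuous_map (prod_topology T T) ?Q (?q \<circ> (\<lambda>p. fst p \<otimes> snd p))"
        by (intro continuous_map_compose[OF _ cont] htg_continuous_mult continuous_map_fst continuous_map_snd)
      from openin_continuous_map_preimage[OF this U] have "openin (prod_topology T T) ?S"
        by (simp add: o_def)
      moreover have "(x, y) \<in> ?S"
        using XY xy q.hom_mult[of x y] by (simp add: htg_topspace)
      ultimately obtain A B where AB: "openin T A" "openin T B" "x \<in> A" "y \<in> B" "A \<times> B \<subseteq> ?S"
        by (rule openin_prod_topologyE)
      have op: "openin ?Q (?q ` A)" "openin ?Q (?q ` B)"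
        using AB open_map_quotient_group unfolding open_map_def by blast+
      have "?q a \<otimes>\<^bsub>G Mod N\<^esub> ?q b \<in> U" if "a \<in> A" "b \<in> B" for a b
        using that AB(5) q.hom_mult[of a b] by (auto simp: htg_topspace simp del: mult_FactGroup)
      then have "?q ` A \<times> ?q ` B \<subseteq> {p \<in> topspace (prod_topology ?Q ?Q). (\<lambda>(X, Y). X \<otimes>\<^bsub>G Mod N\<^esub> Y) p \<in> U}"
        using op[THEN openin_subset] by auto
      then show "\<exists>A B. openin ?Q A \<and> openin ?Q B \<and> X \<in> A \<and> Y \<in> B \<and>
          A \<times> B \<subseteq> {p \<in> topspace (prod_topology ?Q ?Q). (\<lambda>(X, Y). X \<otimes>\<^bsub>G Mod N\<^esub> Y) p \<in> U}"
        using op AB(3,4) xy by blast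
    qed
  qed
  show "continuous_map ?Q ?Q (\<lambda>X. inv\<^bsub>G Mod N\<^esub> X)"
  proof (rule continuous_compose_quotient_map[OF quotient_map_quotient_group])
    have "continuous_map T ?Q (?q \<circ> (\<lambda>x. inv x))"
      by (intro continuous_map_compose[OF _ cont] htg_continuous_inv) simp
    then show "continuous_map T ?Q ((\<lambda>X. inv\<^bsub>G Mod N\<^esub> X) \<circ> ?q)"
      by (rule continuous_map_eq) (simp add: htg_topspace)
  qed
qed

text \<open>A coarser group topology leaves the projection from G continuous, and two topologies for
  which the same surjection is a quotient map coincide.\<close>

lemma minimal_quotient_group:
  assumes "\<And>T'. hausdorff_topological_group (G Mod N) T' \<Longrightarrow> continuous_map T T' (\<lambda>x. N #> x)
      \<Longrightarrow> quotient_map T T' (\<lambda>x. N #> x)"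
  shows "minimal_topological_group (G Mod N) (quotient_group_topology G T N)"
  unfolding minimal_topological_group_def
proof (intro conjI allI impI)
  let ?q = "\<lambda>x. N #> x" and ?Q = "quotient_group_topology G T N"
  show "hausdorff_topological_group (G Mod N) ?Q"
    by (rule hausdorff_topological_group_quotient)
  fix T' assume T': "hausdorff_topological_group (G Mod N) T' \<and> (\<forall>U. openin T' U \<longrightarrow> openin ?Q U)"
  have top: "topspace T' = topspace ?Q"
    using T' topspace_quotient_group by (simp add: hausdorff_topological_group_def)
  have "continuous_map ?Q T' id"
    unfolding continuous_map_def
  proof (intro conjI allI impI)
    fix U assume U: "openin T' U"
    then have "{X \<in> topspace ?Q. id X \<in> U} = U"
      using openin_subset[OF U] top by auto
    then show "openin ?Q {X \<in> topspace ?Q. id X \<in> U}"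
      using T' U by simp
  qed (simp add: top)
  then have "continuous_map T T' (id \<circ> ?q)"
    by (rule continuous_map_compose[OF quotient_imp_continuous_map[OF quotient_map_quotient_group]])
  then have "quotient_map T T' ?q"
    using assms T' by simp
  then have "openin T' U \<longleftrightarrow> openin ?Q U" for U
    using quotient_map_quotient_group top openin_subset unfolding quotient_map_def by metis
  then show "T' = ?Q"
    by (simp add: topology_eq)
qed

end

end

section \<open>Continuous homomorphisms from the special linear group\<close>

text \<open>Vanishing 2x2 minors make X a column times a normalised row, and then X X = (z.u) X. The
  hypotheses are polynomial equations, so they cut out a closed set of matrices.\<close>

lemma rank_one_square_zero:
  fixes X :: "'a::field^'n^'n"
  assumes minors: "\<And>i j k l. X $ i $ j * X $ k $ l = X $ i $ l * X $ k $ j"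
    and sq: "X ** X = 0" and nz: "X \<noteq> 0"
  obtains u z where "u \<noteq> 0" "z \<noteq> 0" "dot z u = 0" "X = outer u z"
proof -
  obtain p q where pq: "X $ p $ q \<noteq> 0"
    using nz by (auto simp: vec_eq_iff)
  define u where "u = (\<chi> i. X $ i $ q)"
  define z where "z = (\<chi> l. X $ p $ l / X $ p $ q)"
  have "X = outer u z"
    using pq minors[of _ q p _] by (simp add: vec_eq_iff outer_def u_def z_def)
  moreover have "u $ p \<noteq> 0" "z $ q \<noteq> 0"
    using pq by (simp_all add: u_def z_def)
  then have "u \<noteq> 0" "z \<noteq> 0"
    by auto
  moreover have "dot z u = (X ** X) $ p $ q / X $ p $ q"
    by (simp add: dot_def u_def z_def matrix_matrix_mult_def sum_divide_distrib)
  ultimately show ?thesis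
    using that sq by simp
qed

lemma continuous_on_matrix_add [continuous_intros]:
  fixes f g :: "_ \<Rightarrow> 'a::topological_monoid_add^'n^'m"
  assumes "continuous_on S f" "continuous_on S g"
  shows "continuous_on S (\<lambda>x. f x + g x)"
  unfolding plus_vec_def by (intro continuous_intros assms)

lemma continuous_on_transvection_scale:
  fixes u z :: "'a::topological_field^'n"
  shows "continuous_on S (\<lambda>s. transvection (s *s u) z)"
  unfolding transvection_def outer_def vector_scalar_mult_def
  by (intro continuous_intros)

text \<open>If \<open>\<phi>(A)\<close> is close to the identity while some \<open>A E\<^sub>a\<^sub>b A\<^sup>-\<^sup>1\<close> is large, then
  \<open>A (1 + s E\<^sub>a\<^sub>b) A\<^sup>-\<^sup>1 = 1 + s A E\<^sub>a\<^sub>b A\<^sup>-\<^sup>1\<close> for a small \<open>s\<close> that normalises the size of the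
  second summand; a limit point of these elements is a transvection in the kernel.\<close>
lemma transvection_in_kernel:
  fixes \<phi> :: "'a::local_field^'n^'n \<Rightarrow> 'h" and H :: "('h, 'b) monoid_scheme"
  assumes H: "hausdorff_topological_group H T"
    and hom: "\<phi> \<in> hom SL H" and cont: "continuous_map SL_topology T \<phi>"
    and t: "t \<noteq> 0" "(\<lambda>n. t ^ n) \<longlonglongrightarrow> 0"
    and V: "compact V" "0 \<in> interior V" "\<And>x. x \<in> V \<Longrightarrow> t * x \<in> V"
    and large: "\<And>W k. openin T W \<Longrightarrow> \<one>\<^bsub>H\<^esub> \<in> W \<Longrightarrow>
      \<exists>A B a b i j. det A = 1 \<and> A ** B = mat 1 \<and> \<phi> A \<in> W \<and> a \<noteq> b \<and> t ^ k * (A $ i $ a * B $ b $ j) \<notin> V"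
  obtains u z where "u \<noteq> 0" "z \<noteq> 0" "dot z u = 0" "\<phi> (transvection u z) = \<one>\<^bsub>H\<^esub>"
proof -
  interpret SL: group "SL :: ('a^'n^'n) monoid" by (rule group_SL)
  interpret H: group H by (rule htg_group[OF H])
  interpret \<phi>: group_hom SL H \<phi>
    by (intro group_hom.intro group_hom_axioms.intro group_SL htg_group[OF H] hom)
  note top_H = htg_topspace[OF H]
  define S where "S = (\<lambda>x. inverse t * x) -` interior V"
  have S: "open S" "0 \<in> S"
    unfolding S_def using V(2) by (auto intro!: open_vimage continuous_intros)
  \<comment> \<open>All entries are in V but not all in S, so X is bounded and away from 0; the
    closed equations make 1 + X a transvection in SL.\<close>
  define K where "K = ({X::'a^'n^'n. \<forall>i j. X $ i $ j \<in> V} - {X. \<forall>i j. X $ i $ j \<in> S}) \<inter>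
      {X. det (mat 1 + X) = 1 \<and> (\<forall>i j. (X ** X) $ i $ j = 0) \<and>
        (\<forall>i j k l. X $ i $ j * X $ k $ l = X $ i $ l * X $ k $ j)}"
  have "open (\<Inter>i. \<Inter>j. (\<lambda>X::'a^'n^'n. X $ i $ j) -` S)"
    by (intro open_INT ballI finite open_vimage S continuous_intros continuous_on_id)
  moreover have "(\<Inter>i. \<Inter>j. (\<lambda>X::'a^'n^'n. X $ i $ j) -` S) = {X. \<forall>i j. X $ i $ j \<in> S}"
    by auto
  moreover have "closed {X::'a^'n^'n. det (mat 1 + X) = 1 \<and> (\<forall>i j. (X ** X) $ i $ j = 0) \<and>
        (\<forall>i j k l. X $ i $ j * X $ k $ l = X $ i $ l * X $ k $ j)}"
    by (intro closed_Collect_conj closed_Collect_all closed_Collect_eq continuous_intros continuous_on_id)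
  ultimately have "compact K"
    unfolding K_def by (intro compact_Int_closed compact_diff compact_matrices V) simp_all
  then have "compact ((\<lambda>X. mat 1 + X) ` K)"
    by (intro compact_continuous_image continuous_intros continuous_on_id)
  moreover have "(\<lambda>X. mat 1 + X) ` K \<subseteq> carrier SL"
    by (auto simp: K_def carrier_SL)
  ultimately have "compactin SL_topology ((\<lambda>X. mat 1 + X) ` K)"
    by (simp add: SL_topology_def compactin_subtopology)
  then have cl: "closedin T (\<phi> ` (\<lambda>X. mat 1 + X) ` K)"
    by (intro compactin_imp_closedin htg_Hausdorff[OF H] image_compactin[OF _ cont])
  have "\<one>\<^bsub>H\<^esub> \<in> \<phi> ` (\<lambda>X. mat 1 + X) ` K"
  proof (rule ccontr)
    assume "\<not> ?thesis"
    then have W: "openin T (topspace T - \<phi> ` (\<lambda>X. mat 1 + X) ` K)" (is "openin T ?W")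
        "\<one>\<^bsub>H\<^esub> \<in> topspace T - \<phi> ` (\<lambda>X. mat 1 + X) ` K"
      using openin_diff[OF openin_topspace cl] by (auto simp: top_H)
    obtain W1 W2 where W12: "openin T W1" "openin T W2" "\<one>\<^bsub>H\<^esub> \<in> W1" "\<one>\<^bsub>H\<^esub> \<in> W2"
      "\<And>x y. x \<in> W1 \<Longrightarrow> y \<in> W2 \<Longrightarrow> x \<otimes>\<^bsub>H\<^esub> y \<otimes>\<^bsub>H\<^esub> inv\<^bsub>H\<^esub> x \<in> ?W"
      by (rule htg_conj_nhds[OF H W]) blast
    let ?e = "\<lambda>a b s. transvection (s *s axis a 1) (axis b 1) :: 'a^'n^'n"
    have small: "eventually (\<lambda>n. a \<noteq> b \<longrightarrow> \<phi> (?e a b (t ^ n)) \<in> W2) sequentially" for a b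
    proof (cases "a = b")
      case False
      have det: "det (?e a b s) = 1" for s
        using False by (intro det_transvection) (simp add: axis_nth_if)
      have "continuous_map euclidean SL_topology (?e a b)"
        unfolding SL_topology_def continuous_map_in_subtopology
        by (auto simp: carrier_SL det intro: continuous_on_transvection_scale)
      from openin_continuous_map_preimage[OF continuous_map_compose[OF this cont] W12(2)]
      have "open {s. \<phi> (?e a b s) \<in> W2}"
        by (simp add: o_def)
      moreover have "0 \<in> {s. \<phi> (?e a b s) \<in> W2}"
        using W12(4) \<phi>.hom_one by (simp add: one_SL)
      ultimately have "eventually (\<lambda>n. t ^ n \<in> {s. \<phi> (?e a b s) \<in> W2}) sequentially"
        using t(2) topological_tendstoD by blast
      then show ?thesis by simp
    qed simp
    \<comment> \<open>The exponent k must be uniform in (a, b), since \<open>large\<close> supplies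
      the pair only after k is fixed.\<close>
    then have "eventually (\<lambda>n. \<forall>a b. a \<noteq> b \<longrightarrow> \<phi> (?e a b (t ^ n)) \<in> W2) sequentially"
      by (intro eventually_all_finite)
    then obtain k where k: "\<And>n a b. n \<ge> k \<Longrightarrow> a \<noteq> b \<Longrightarrow> \<phi> (?e a b (t ^ n)) \<in> W2"
      unfolding eventually_sequentially by blast
    obtain A B a b i j where AB: "det A = 1" "A ** B = mat 1" "\<phi> A \<in> W1" "a \<noteq> b"
        "t ^ k * (A $ i $ a * B $ b $ j) \<notin> V"
      using large[OF W12(1,3), of k] by blast
    have BA: "B ** A = mat 1"
      using AB(2) matrix_left_right_inverse by blast
    define u where "u = A *v axis a 1"
    define z where "z = axis b 1 v* B"
    have u: "u $ l = A $ l $ a" and z: "z $ l = B $ b $ l" for l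
      by (simp_all add: u_def z_def matrix_vector_mult_def vector_matrix_mult_def axis_nth_if
          if_distrib[of "\<lambda>x. _ * x"] if_distrib[of "\<lambda>x. x * _"] cong: if_cong)
    have zu: "dot z u = 0"
      unfolding u_def z_def dot_vector_matrix matrix_vector_mul_assoc BA
      using AB(4) by (simp add: axis_nth_if)
    define in_V where "in_V n \<longleftrightarrow> (\<forall>i j. t ^ n * (u $ i * z $ j) \<in> V)" for n
    have "eventually (\<lambda>n. \<forall>i j. t ^ n * (u $ i * z $ j) \<in> interior V) sequentially"
    proof (intro eventually_all_finite)
      fix i j
      have "(\<lambda>n. t ^ n * (u $ i * z $ j)) \<longlonglongrightarrow> 0 * (u $ i * z $ j)"
        by (intro tendsto_intros t)
      then show "eventually (\<lambda>n. t ^ n * (u $ i * z $ j) \<in> interior V) sequentially"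
        using topological_tendstoD[OF _ open_interior] V(2) by force
    qed
    then obtain n where "in_V n"
      unfolding in_V_def eventually_sequentially using interior_subset by blast
    \<comment> \<open>The least normalising exponent: the entries of t^n u z^T lie in V, but at n -
      1 some entry escapes, which keeps X off S. As \<open>in_V\<close> persists upwards and fails
      at k, also n > k, so the image of 1 + t^n E_ab lies in \<open>W2\<close>.\<close>
    then obtain n where n: "in_V n" "\<And>m. m < n \<Longrightarrow> \<not> in_V m"
      using exists_least_iff[of in_V] by blast
    have step: "in_V (Suc m)" if "in_V m" for m
      using that V(3) unfolding in_V_def by (auto simp: mult.assoc)
    have "\<not> in_V k"
      using AB(5) unfolding in_V_def u z by blast
    moreover have "in_V m" if "m \<ge> n" for m
      using that n(1) by (induction m rule: dec_induct) (auto intro: step)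
    ultimately have "n > k"
      using not_less by blast
    then obtain m where m: "n = Suc m"
      using not0_implies_Suc[of n] by auto
    define X where "X = outer (t ^ n *s u) z"
    have X: "X $ i $ j = t ^ n * (u $ i * z $ j)" for i j
      by (simp add: X_def outer_def)
    have X1: "mat 1 + X = A ** ?e a b (t ^ n) ** B"
      unfolding transvection_conj[OF AB(2)] by (simp add: X_def transvection_def u_def z_def vec.scale)
    have "X \<in> K"
      unfolding K_def
    proof (intro IntI DiffI CollectI notI conjI)
      show "\<forall>i j. X $ i $ j \<in> V"
        using n(1) by (simp add: X in_V_def)
    next
      assume "X \<in> {X. \<forall>i j. X $ i $ j \<in> S}"
      then have "\<forall>i j. inverse t * (t ^ n * (u $ i * z $ j)) \<in> V"
        using interior_subset by (auto simp: X S_def)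
      then have "in_V m"
        using t(1) by (simp add: in_V_def m mult.assoc[symmetric])
      then show False
        using n(2)[of m] m by simp
    next
      have "det (mat 1 + X) = 1 * 1 * det B"
        unfolding X1 det_mul using AB(1,4) by (subst det_transvection) (simp_all add: axis_nth_if)
      then show "det (mat 1 + X) = 1"
        using det_right_inverse_1[OF AB(1,2)] by simp
    next
      show "\<forall>i j. (X ** X) $ i $ j = 0"
        by (simp add: X_def matrix_mult_outer outer_mult_vector zu)
    qed (simp add: X mult_ac)
    then have "\<phi> (mat 1 + X) \<in> \<phi> ` (\<lambda>X. mat 1 + X) ` K"
      by blast
    moreover have "\<phi> (mat 1 + X) = \<phi> A \<otimes>\<^bsub>H\<^esub> \<phi> (?e a b (t ^ n)) \<otimes>\<^bsub>H\<^esub> inv\<^bsub>H\<^esub> (\<phi> A)"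
    proof -
      have mem: "A \<in> carrier SL" "?e a b (t ^ n) \<in> carrier SL"
        using AB(1,4) by (auto simp: carrier_SL axis_nth_if intro!: det_transvection)
      have "mat 1 + X = A \<otimes>\<^bsub>SL\<^esub> ?e a b (t ^ n) \<otimes>\<^bsub>SL\<^esub> inv\<^bsub>SL\<^esub> A"
        by (simp add: X1 mult_SL inv_SL[OF AB(1,2)])
      then show ?thesis
        using mem by (simp only: \<phi>.hom_mult \<phi>.hom_inv SL.m_closed SL.inv_closed)
    qed
    moreover have "\<phi> A \<otimes>\<^bsub>H\<^esub> \<phi> (?e a b (t ^ n)) \<otimes>\<^bsub>H\<^esub> inv\<^bsub>H\<^esub> (\<phi> A) \<in> ?W"
      using AB(3,4) \<open>n > k\<close> by (intro W12(5) k) auto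
    ultimately show False by auto
  qed
  then obtain X where X: "X \<in> K" "\<phi> (mat 1 + X) = \<one>\<^bsub>H\<^esub>"
    by auto
  have "X \<noteq> 0"
    using X(1) S(2) by (auto simp: K_def)
  moreover have "X ** X = 0"
    using X(1) by (simp add: K_def vec_eq_iff)
  moreover have "X $ i $ j * X $ k $ l = X $ i $ l * X $ k $ j" for i j k l
    using X(1) unfolding K_def by blast
  ultimately obtain u z where "u \<noteq> 0" "z \<noteq> 0" "dot z u = 0" "X = outer u z"
    by (metis rank_one_square_zero)
  then show ?thesis
    using that X(2) by (simp add: transvection_def)
qed

lemma quotient_map_from_SL:
  fixes \<phi> :: "'a::local_field^'n^'n \<Rightarrow> 'h" and H :: "('h, 'b) monoid_scheme"
  assumes two: "(2::'a) \<noteq> 0" and H: "hausdorff_topological_group H T"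
    and hom: "\<phi> \<in> hom SL H" and cont: "continuous_map SL_topology T \<phi>"
    and surj: "\<phi> ` carrier SL = carrier H"
  shows "quotient_map SL_topology T \<phi>"
proof -
  interpret \<phi>: group_hom SL H \<phi>
    by (intro group_hom.intro group_hom_axioms.intro group_SL htg_group[OF H] hom)
  note top_H = htg_topspace[OF H]
  obtain t :: 'a and V where t: "t \<noteq> 0" "compact V" "0 \<in> interior V" "\<And>x. x \<in> V \<Longrightarrow> t * x \<in> V"
      "(\<lambda>n. t ^ n) \<longlonglongrightarrow> 0"
    by (rule local_field_topologically_nilpotent) blast
  show ?thesis
  proof (cases "\<forall>W k. openin T W \<longrightarrow> \<one>\<^bsub>H\<^esub> \<in> W \<longrightarrow>
      (\<exists>A B a b i j. det A = 1 \<and> A ** B = mat 1 \<and> \<phi> A \<in> W \<and> a \<noteq> b \<and> t ^ k * (A $ i $ a * B $ b $ j) \<notin> V)")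
    case True
    then obtain u z where uz: "u \<noteq> 0" "z \<noteq> 0" "dot z u = 0" "\<phi> (transvection u z) = \<one>\<^bsub>H\<^esub>"
      using transvection_in_kernel[OF H hom cont t(1,5,2,3,4)] by blast
    have "transvection u z \<in> kernel SL H \<phi>"
      using uz by (simp add: kernel_def carrier_SL det_transvection)
    then have "kernel SL H \<phi> = carrier SL"
      by (rule normal_SL_eq_carrier[OF \<phi>.normal_kernel two uz(1-3)])
    then have triv: "\<phi> g = \<one>\<^bsub>H\<^esub>" if "g \<in> carrier SL" for g
      using that by (auto simp: kernel_def)
    \<comment> \<open>On a one-point space the quotient condition only concerns the empty set and
      the whole space.\<close>
    then have top: "topspace T = {\<one>\<^bsub>H\<^esub>}"
      using surj \<phi>.G.one_closed by (force simp: top_H)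
    show ?thesis
      unfolding quotient_map_def
    proof (intro conjI allI impI)
      fix U assume "U \<subseteq> topspace T"
      then have "U = {} \<or> U = topspace T"
        using top by auto
      moreover have "{x \<in> topspace SL_topology. \<phi> x \<in> topspace T} = topspace SL_topology"
        using triv top by auto
      moreover have "openin SL_topology (carrier SL :: ('a^'n^'n) set)"
        using openin_topspace[of "SL_topology :: ('a^'n^'n) topology"] by simp
      ultimately show "openin SL_topology {x \<in> topspace SL_topology. \<phi> x \<in> U} = openin T U"
        by auto
    qed (use surj in \<open>simp add: top_H\<close>)
  next
    case False
    then obtain W k where W: "openin T W" "\<one>\<^bsub>H\<^esub> \<in> W"
      and bd: "\<And>A B a b i j. det A = 1 \<Longrightarrow> A ** B = mat 1 \<Longrightarrow> \<phi> A \<in> W \<Longrightarrow> a \<noteq> b \<Longrightarrow>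
        t ^ k * (A $ i $ a * B $ b $ j) \<in> V"
      by (auto simp del: not_all) metis
    \<comment> \<open>R is t^-k V, the bound that the failing case imposes on all entries of A E_ab
      A^-1 when \<open>\<phi> A\<close> lies in W.\<close>
    define R where "R = (\<lambda>x. inverse (t ^ k) * x) ` V"
    have "compact R"
      unfolding R_def by (intro compact_continuous_image t continuous_intros)
    then obtain C :: "('a^'n^'n) set" where C: "compact C"
      "\<And>A B. det A = 1 \<Longrightarrow> A ** B = mat 1 \<Longrightarrow>
        (\<And>a b j k. a \<noteq> b \<Longrightarrow> A $ j $ a * B $ b $ k \<in> R) \<Longrightarrow> A \<in> C"
      by (rule SL_bounded_adjoint) blast
    have R: "x \<in> R" if "t ^ k * x \<in> V" for x
      unfolding R_def using that t(1) by (intro image_eqI[of _ _ "t ^ k * x"]) (simp_all add: field_simps)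
    have "closed {A::'a^'n^'n. det A = 1}"
      by (intro closed_Collect_eq continuous_intros continuous_on_id)
    then have "compact (C \<inter> carrier SL)"
      using C(1) by (auto simp: SL_def)
    then have "compactin SL_topology (C \<inter> carrier SL)"
      by (simp add: SL_topology_def compactin_subtopology)
    moreover have "A \<in> C \<inter> carrier SL" if "A \<in> carrier SL" "\<phi> A \<in> W" for A
    proof
      have A: "det A = 1"
        using that(1) by (simp add: carrier_SL)
      show "A \<in> C"
        by (rule C(2)[OF A SL_right_inverse[OF A]])
          (rule R, rule bd[OF A SL_right_inverse[OF A] that(2)])
    qed fact
    ultimately show ?thesis
      by (intro htg_quotient_map_if_locally_proper[OF hausdorff_topological_group_SL H hom cont surj W])
  qed
qed

section \<open>The center and total minimality\<close>

lemma normal_group_center: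
  assumes "group G"
  shows "group_center G \<lhd> G"
proof -
  interpret group G by fact
  have sub: "group_center G \<subseteq> carrier G"
    by (auto simp: group_center_def)
  have comm: "z \<otimes>\<^bsub>G\<^esub> g = g \<otimes>\<^bsub>G\<^esub> z" if "z \<in> group_center G" "g \<in> carrier G" for z g
    using that unfolding group_center_def by blast
  have "z \<otimes>\<^bsub>G\<^esub> w \<in> group_center G" if "z \<in> group_center G" "w \<in> group_center G" for z w
  proof -
    have "z \<otimes>\<^bsub>G\<^esub> w \<otimes>\<^bsub>G\<^esub> g = g \<otimes>\<^bsub>G\<^esub> (z \<otimes>\<^bsub>G\<^esub> w)" if "g \<in> carrier G" for g
    proof -
      have zw: "z \<in> carrier G" "w \<in> carrier G" "z \<otimes>\<^bsub>G\<^esub> g = g \<otimes>\<^bsub>G\<^esub> z" "w \<otimes>\<^bsub>G\<^esub> g = g \<otimes>\<^bsub>G\<^esub> w"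
        using \<open>z \<in> group_center G\<close> \<open>w \<in> group_center G\<close> that sub comm by blast+
      have "z \<otimes>\<^bsub>G\<^esub> w \<otimes>\<^bsub>G\<^esub> g = (z \<otimes>\<^bsub>G\<^esub> g) \<otimes>\<^bsub>G\<^esub> w"
        using zw(1,2,4) that by (simp only: m_assoc)
      then show ?thesis
        unfolding zw(3) using zw(1,2) that by (simp only: m_assoc)
    qed
    moreover have "z \<otimes>\<^bsub>G\<^esub> w \<in> carrier G"
      using that sub by blast
    ultimately show ?thesis
      unfolding group_center_def by blast
  qed
  moreover have "inv\<^bsub>G\<^esub> z \<in> group_center G" if "z \<in> group_center G" for z
  proof -
    have "inv\<^bsub>G\<^esub> z \<otimes>\<^bsub>G\<^esub> g = g \<otimes>\<^bsub>G\<^esub> inv\<^bsub>G\<^esub> z" if "g \<in> carrier G" for g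
    proof -
      have "z \<in> carrier G" "z \<otimes>\<^bsub>G\<^esub> inv\<^bsub>G\<^esub> g = inv\<^bsub>G\<^esub> g \<otimes>\<^bsub>G\<^esub> z"
        using \<open>z \<in> group_center G\<close> that sub comm inv_closed by blast+
      then have "inv\<^bsub>G\<^esub> (z \<otimes>\<^bsub>G\<^esub> inv\<^bsub>G\<^esub> g) = inv\<^bsub>G\<^esub> (inv\<^bsub>G\<^esub> g \<otimes>\<^bsub>G\<^esub> z)" "z \<in> carrier G"
        by simp_all
      then show ?thesis
        using that by (simp only: inv_mult_group inv_closed inv_inv)
    qed
    moreover have "inv\<^bsub>G\<^esub> z \<in> carrier G"
      using that sub by blast
    ultimately show ?thesis
      unfolding group_center_def by blast
  qed
  moreover have "\<one>\<^bsub>G\<^esub> \<in> group_center G"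
    by (simp add: group_center_def)
  ultimately have "subgroup (group_center G) G"
    using sub by (intro subgroup.intro)
  moreover have "x \<otimes>\<^bsub>G\<^esub> z \<otimes>\<^bsub>G\<^esub> inv\<^bsub>G\<^esub> x \<in> group_center G"
    if "x \<in> carrier G" "z \<in> group_center G" for x z
  proof -
    have "x \<otimes>\<^bsub>G\<^esub> z \<otimes>\<^bsub>G\<^esub> inv\<^bsub>G\<^esub> x = z"
      using that sub inv_solve_right[of z "x \<otimes>\<^bsub>G\<^esub> z" x] comm[of z x]
      by (metis inv_solve_right m_closed subsetD)
    then show ?thesis using that by simp
  qed
  ultimately show ?thesis
    by (simp add: normal_inv_iff)
qed

lemma closedin_center_SL:
  "closedin SL_topology (group_center (SL :: ('a::topological_field^'n^'n) monoid))"
proof -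
  have cl: "closed (\<Inter>B\<in>carrier SL. {A::'a^'n^'n. \<forall>i j. (A ** B) $ i $ j = (B ** A) $ i $ j})"
    by (intro closed_INT ballI closed_Collect_all closed_Collect_eq continuous_intros continuous_on_id)
  have "group_center SL = carrier SL \<inter>
      (\<Inter>B\<in>carrier SL. {A::'a^'n^'n. \<forall>i j. (A ** B) $ i $ j = (B ** A) $ i $ j})"
    by (auto simp: group_center_def mult_SL vec_eq_iff)
  then show ?thesis
    unfolding SL_topology_def by (simp only: closedin_closed_Int[OF cl])
qed

lemma totally_minimal_SL:
  assumes two: "(2::'a::local_field) \<noteq> 0"
  shows "totally_minimal_topological_group (SL :: ('a^'n^'n) monoid) SL_topology"
  unfolding totally_minimal_topological_group_def
proof (intro conjI allI impI, rule hausdorff_topological_group_SL, elim conjE)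
  fix N :: "('a^'n^'n) set" assume N: "N \<lhd> SL" "closedin SL_topology N"
  show "minimal_topological_group (SL Mod N) (quotient_group_topology SL SL_topology N)"
    by (rule minimal_quotient_group[OF hausdorff_topological_group_SL N],
        rule quotient_map_from_SL[OF two _ normal.r_coset_hom_Mod[OF N(1)]])
      (simp_all add: carrier_FactGroup)
qed

text \<open>The composite of both projections is a continuous homomorphism from SL, hence a quotient
  map, and the second factor of such a composite is again one. This avoids identifying (SL/Z)/N with
  a quotient of SL.\<close>

lemma totally_minimal_PSL:
  assumes two: "(2::'a::local_field) \<noteq> 0"
  shows "totally_minimal_topological_group (PSL :: ('a^'n^'n) set monoid) PSL_topology"
proof -
  let ?Z = "group_center (SL :: ('a^'n^'n) monoid)"
  have Z: "?Z \<lhd> SL" "closedin SL_topology ?Z"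
    by (rule normal_group_center[OF group_SL], rule closedin_center_SL)
  note htg = hausdorff_topological_group_quotient[OF hausdorff_topological_group_SL Z]
  note quot = quotient_map_quotient_group[OF hausdorff_topological_group_SL Z]
  have "minimal_topological_group ((SL Mod ?Z) Mod N)
      (quotient_group_topology (SL Mod ?Z) (quotient_group_topology SL SL_topology ?Z) N)"
    if N: "N \<lhd> SL Mod ?Z" "closedin (quotient_group_topology SL SL_topology ?Z) N" for N
  proof (rule minimal_quotient_group[OF htg N])
    let ?q = "\<lambda>x. ?Z #>\<^bsub>SL\<^esub> x" and ?p = "\<lambda>X. N #>\<^bsub>SL Mod ?Z\<^esub> X"
    fix T' assume T': "hausdorff_topological_group ((SL Mod ?Z) Mod N) T'"
      "continuous_map (quotient_group_topology SL SL_topology ?Z) T' ?p"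
    have "quotient_map SL_topology T' (?p \<circ> ?q)"
    proof (rule quotient_map_from_SL[OF two T'(1)])
      show "?p \<circ> ?q \<in> hom SL ((SL Mod ?Z) Mod N)"
        by (rule hom_compose[OF normal.r_coset_hom_Mod[OF Z(1)] normal.r_coset_hom_Mod[OF N(1)]])
      show "continuous_map SL_topology T' (?p \<circ> ?q)"
        by (rule continuous_map_compose[OF quotient_imp_continuous_map[OF quot] T'(2)])
      show "(?p \<circ> ?q) ` carrier SL = carrier ((SL Mod ?Z) Mod N)"
        by (simp add: carrier_FactGroup image_comp)
    qed
    then show "quotient_map (quotient_group_topology SL SL_topology ?Z) T' ?p"
      by (rule quotient_map_from_composition[OF quotient_imp_continuous_map[OF quot] T'(2)])
  qed
  then show ?thesis
    unfolding totally_minimal_topological_group_def PSL_def PSL_topology_def using htg by blast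
qed

theorem theorem4p3:
  assumes "CHAR('a::local_field) \<noteq> 2"
  shows "totally_minimal_topological_group (SL :: ('a ^ 'n::finite ^ 'n) monoid) SL_topology \<and>
         totally_minimal_topological_group (PSL :: ('a ^ 'n ^ 'n) set monoid) PSL_topology"
proof -
  have two: "(2::'a) \<noteq> 0"
  proof
    assume "(2::'a) = 0"
    then have "CHAR('a) dvd 2"
      using of_nat_eq_0_iff_char_dvd[where 'a = 'a, of 2] by simp
    then have "CHAR('a) = 1 \<or> CHAR('a) = 2"
      using two_is_prime_nat prime_nat_iff by blast
    then show False
      using assms by simp
  qed
  show ?thesis
    by (rule conjI[OF totally_minimal_SL[OF two] totally_minimal_PSL[OF two]])
qed

end
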